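(* Let $s \ge 5$ be a fixed integer with $s \not\equiv 0 \pmod 3$. Then there are positive constants $a$ and $b$ (depending only on $s$) such that for all sufficiently large integers $t$, $$2^{at} < r(C_s^3, K_t^3) < 2^{b t^2 \log t}.$$
   Context: A $3$-graph (triple system) $H$ with vertex set $V(H)$ is a collection of $3$-element subsets of $V(H)$, called edges. $K_n^3$ is the complete $3$-graph on $n$ vertices (all $3$-subsets are edges). For $s \ge 4$, the tight cycle $C_s^3$ is the $3$-graph with vertex set $\mathbb{Z}_s$ (integers modulo $s$) and edge set $\{\{i,i+1,i+2\} : i \in \mathbb{Z}_s\}$. For $3$-graphs $F, G$, the Ramsey number $r(F,G)$ is the minimum $n$ such that every coloring of the edges of $K_n^3$ with colors red and blue contains a copy of $F$ (as a not necessarily induced subhypergraph) all of whose edges are red, or a copy of $G$ all of whose edges are blue. *)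

theory Defs
  imports Complex_Main "HOL-Library.Ramsey"
begin

record 'a triple_system =
  verts :: "'a set"
  edges :: "'a set set"

definition is_3graph :: "'a triple_system \<Rightarrow> bool" where
  "is_3graph H \<longleftrightarrow> (\<forall>e\<in>edges H. e \<subseteq> verts H \<and> card e = 3)"

definition complete3 :: "nat \<Rightarrow> nat triple_system" where
  "complete3 n = \<lparr>verts = {..<n}, edges = {e. e \<subseteq> {..<n} \<and> card e = 3}\<rparr>"

text \<open>The residues modulo \<open>s\<close> are represented by \<open>0, \<dots>, s - 1\<close>.\<close>

definition tight_cycle3 :: "nat \<Rightarrow> nat triple_system" where
  "tight_cycle3 s =
    \<lparr>verts = {..<s}, edges = {{i, (i + 1) mod s, (i + 2) mod s} | i. i < s}\<rparr>"

text \<open>Copies are not necessarily induced.\<close>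

definition contains_copy :: "'b triple_system \<Rightarrow> 'a triple_system \<Rightarrow> bool" where
  "contains_copy H F \<longleftrightarrow>
    (\<exists>f. inj_on f (verts F) \<and> f ` verts F \<subseteq> verts H \<and> (\<forall>e\<in>edges F. f ` e \<in> edges H))"

datatype colour = Red | Blue

definition colour_class ::
    "'a triple_system \<Rightarrow> ('a set \<Rightarrow> colour) \<Rightarrow> colour \<Rightarrow> 'a triple_system" where
  "colour_class H c k = \<lparr>verts = verts H, edges = {e \<in> edges H. c e = k}\<rparr>"

definition arrows3 :: "nat \<Rightarrow> 'a triple_system \<Rightarrow> 'b triple_system \<Rightarrow> bool" where
  "arrows3 n F G \<longleftrightarrow>
    (\<forall>c. contains_copy (colour_class (complete3 n) c Red) F \<or>
         contains_copy (colour_class (complete3 n) c Blue) G)"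

definition ramsey3 :: "'a triple_system \<Rightarrow> 'b triple_system \<Rightarrow> nat" where
  "ramsey3 F G = (LEAST n. arrows3 n F G)"

lemma is_3graph_complete3: "is_3graph (complete3 n)"
  by (simp add: is_3graph_def complete3_def)

lemma is_3graph_tight_cycle3:
  assumes "s \<ge> 4"
  shows "is_3graph (tight_cycle3 s)"
proof -
  have "card {i, (i + 1) mod s, (i + 2) mod s} = 3" if "i < s" for i
  proof -
    consider "i + 2 < s" | "i + 2 = s" | "i + 1 = s" using \<open>i < s\<close> by linarith
    then have "i \<noteq> (i + 1) mod s \<and> i \<noteq> (i + 2) mod s \<and> (i + 1) mod s \<noteq> (i + 2) mod s"
    proof cases
      case 3
      then have "i + 2 = s + 1" by simp
      then have "(i + 2) mod s = 1" using assms by (metis mod_add_self1 mod_less less_le_trans one_less_numeral_iff semiring_norm(76))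
      with 3 assms show ?thesis by auto
    qed (use assms in auto)
    then show ?thesis by simp
  qed
  with assms show ?thesis by (auto simp: is_3graph_def tight_cycle3_def)
qed

text \<open>By Ramsey's theorem, the minimum defining \<open>ramsey3\<close> is attained.\<close>

lemma contains_copyI_clique:
  assumes F: "is_3graph F" "finite (verts F)"
    and K: "K \<subseteq> verts H" "finite K" "card K = card (verts F)"
    and E: "\<And>e. e \<subseteq> K \<Longrightarrow> card e = 3 \<Longrightarrow> e \<in> edges H"
  shows "contains_copy H F"
proof -
  obtain f where f: "bij_betw f (verts F) K"
    using F(2) K(2,3) finite_same_card_bij by metis
  have "f ` e \<in> edges H" if "e \<in> edges F" for e
  proof (rule E)
    have e: "e \<subseteq> verts F" "card e = 3" using that F(1) by (auto simp: is_3graph_def)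
    with f show "f ` e \<subseteq> K" by (auto simp: bij_betw_def)
    show "card (f ` e) = 3"
      using e f by (metis bij_betw_def card_image inj_on_subset)
  qed
  with f K(1) show ?thesis
    unfolding contains_copy_def bij_betw_def by blast
qed

lemma arrows3_ramsey3:
  assumes "is_3graph F" "finite (verts F)" "is_3graph G" "finite (verts G)"
  shows "arrows3 (ramsey3 F G) F G"
proof -
  obtain n :: nat where n: "partn_lst {..<n} [card (verts F), card (verts G)] 3"
    using ramsey_full[of "[card (verts F), card (verts G)]" 3] by blast
  have "arrows3 n F G"
    unfolding arrows3_def
  proof
    fix c :: "nat set \<Rightarrow> colour"
    let ?g = "\<lambda>e. if c e = Red then 0 else 1 :: nat"
    have "?g \<in> nsets {..<n} 3 \<rightarrow> {..<length [card (verts F), card (verts G)]}" by auto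
    with n obtain i where i: "i < length [card (verts F), card (verts G)]"
        and "monochromatic {..<n} ([card (verts F), card (verts G)] ! i) 3 ?g i"
      unfolding partn_lst_def by meson
    then obtain K where K: "K \<in> nsets {..<n} ([card (verts F), card (verts G)] ! i)"
        and mono: "?g ` nsets K 3 \<subseteq> {i}"
      unfolding monochromatic_def by meson
    have col: "?g e = i" if "e \<subseteq> K" "card e = 3" for e
    proof -
      have "e \<in> nsets K 3" using that by (simp add: nsets_def card_ge_0_finite)
      with mono show ?thesis by blast
    qed
    have sub: "K \<subseteq> {..<n}" "finite K" using K by (auto simp: nsets_def)
    consider "i = 0" | "i = 1" using i by (auto simp: less_Suc_eq)
    then show "contains_copy (colour_class (complete3 n) c Red) F \<or>
        contains_copy (colour_class (complete3 n) c Blue) G"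
    proof cases
      case 1
      have "contains_copy (colour_class (complete3 n) c Red) F"
      proof (rule contains_copyI_clique[OF assms(1,2), of K])
        fix e assume e: "e \<subseteq> K" "card e = 3"
        then have "c e = Red" using col[OF e] 1 by (simp split: if_splits)
        with e sub show "e \<in> edges (colour_class (complete3 n) c Red)"
          by (auto simp: colour_class_def complete3_def)
      qed (use K sub 1 in \<open>auto simp: nsets_def colour_class_def complete3_def\<close>)
      then show ?thesis ..
    next
      case 2
      have "contains_copy (colour_class (complete3 n) c Blue) G"
      proof (rule contains_copyI_clique[OF assms(3,4), of K])
        fix e assume e: "e \<subseteq> K" "card e = 3"
        then have "c e = Blue" using col[OF e] 2 by (cases "c e") auto
        with e sub show "e \<in> edges (colour_class (complete3 n) c Blue)"
          by (auto simp: colour_class_def complete3_def)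
      qed (use K sub 2 in \<open>auto simp: nsets_def colour_class_def complete3_def\<close>)
      then show ?thesis ..
    qed
  qed
  then show ?thesis unfolding ramsey3_def by (rule LeastI)
qed

end

theory Submission
  imports Defs "HOL-Library.FuncSet" "HOL-Number_Theory.Cong"
begin

text \<open>Lower bound: give every ordered pair \<open>(a, b)\<close> a random role in \<open>{0, 1, 2}\<close> and colour a triple red
  if each of its vertices has the same role towards the other two and the three roles differ. Around a
  red tight cycle the roles have period 3, so its length is divisible by 3. A fixed \<open>t\<close>-set contains
  about \<open>t\<^sup>2 / 9\<close> pair-disjoint triples, hence is blue with probability \<open>exp (- \<Omega>(t\<^sup>2))\<close>.

  Upper bound: expose vertices one at a time, keeping a set \<open>S\<close> of remaining vertices. A new vertex is
  compared with a blue clique \<open>U\<close>; if it is red to some \<open>u \<in> U\<close> it is compared with the vertices that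
  are already red to \<open>u\<close>; if it is red to one of those as well, then either its link in \<open>S\<close> contains a
  red pair, which completes a red configuration containing \<open>C\<^sub>5\<close> and \<open>K\<^sub>4\<close>, or it is blue to all pairs
  in \<open>S\<close>. Fewer than \<open>t\<^sup>2\<close> steps are possible without a blue clique, and each one costs a factor
  \<open>O(t\<^sup>2)\<close> of \<open>S\<close>. For \<open>s > 5\<close> the cycle is contained in a blow-up of \<open>K\<^sub>4\<close>, which
  supersaturation provides at the price of a constant power.\<close>

section \<open>A random colouring without red tight cycles\<close>

text \<open>Independence in counting form: for a uniformly random \<open>f\<close> the events
  "\<open>f\<close> agrees with \<open>p\<close> on \<open>b j\<close>" concern disjoint sets of
  coordinates, and each has probability at least \<open>1 / card C ^ m\<close>. The induction
  removes one block at a time.\<close>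

lemma card_avoiding_blocks:
  fixes b :: "'j \<Rightarrow> 'i set" and p :: "'i \<Rightarrow> 'c"
  assumes "finite I" "finite C" "C \<noteq> {}" "finite J"
    and "\<And>j. j \<in> J \<Longrightarrow> b j \<subseteq> I \<and> card (b j) \<le> m \<and> p ` b j \<subseteq> C"
    and "\<And>j k. j \<in> J \<Longrightarrow> k \<in> J \<Longrightarrow> j \<noteq> k \<Longrightarrow> b j \<inter> b k = {}"
  shows "real (card {f \<in> I \<rightarrow>\<^sub>E C. \<forall>j\<in>J. \<exists>i\<in>b j. f i \<noteq> p i})
    \<le> (1 - 1 / real (card C) ^ m) ^ card J * real (card C) ^ card I"
  using assms(4-6)
proof (induction J rule: finite_induct)
  case empty
  then show ?case using assms(1) by (simp add: card_PiE)
next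
  case (insert j J)
  define F where "F J = {f \<in> I \<rightarrow>\<^sub>E C. \<forall>j\<in>J. \<exists>i\<in>b j. f i \<noteq> p i}" for J
  define G where "G = {f \<in> F J. \<forall>i\<in>b j. f i = p i}"
  have bj: "b j \<subseteq> I" "card (b j) \<le> m" "p ` b j \<subseteq> C" using insert.prems(1)[of j] by auto
  have disj: "b j \<inter> b k = {}" if "k \<in> J" for k using insert.prems(2)[of j k] insert.hyps that by auto
  have fin: "finite (F J)" for J using assms(1,2) by (simp add: F_def finite_PiE)
  have fbj: "finite (b j)" using bj(1) assms(1) by (rule finite_subset)
  have IH: "real (card (F J)) \<le> (1 - 1 / real (card C) ^ m) ^ card J * real (card C) ^ card I"
    unfolding F_def by (rule insert.IH) (use insert.prems in auto)
  show ?case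
  proof -
    have c1: "real (card C) \<ge> 1" using assms(2,3) by (simp add: Suc_le_eq card_gt_0_iff)
    \<comment> \<open>Overwriting \<open>f\<close> by \<open>p\<close> on \<open>b j\<close> while
      recording the old values is injective. Disjointness of the blocks keeps the other constraints
      intact, so at least a fraction \<open>1 / card C ^ m\<close> of \<open>F J\<close> lies in
      \<open>G\<close>.\<close>
    define \<phi> where "\<phi> f = (\<lambda>i. if i \<in> b j then p i else f i, restrict f (b j))" for f :: "'i \<Rightarrow> 'c"
    have "inj_on \<phi> (F J)"
    proof (rule inj_onI)
      fix f g assume "\<phi> f = \<phi> g"
      then have 1: "(\<lambda>i. if i \<in> b j then p i else f i) = (\<lambda>i. if i \<in> b j then p i else g i)"
        and 2: "restrict f (b j) = restrict g (b j)" by (auto simp: \<phi>_def)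
      show "f = g"
      proof
        fix i
        show "f i = g i" using fun_cong[OF 1, of i] fun_cong[OF 2, of i] by (cases "i \<in> b j") auto
      qed
    qed
    moreover have "\<phi> ` F J \<subseteq> G \<times> (b j \<rightarrow>\<^sub>E C)"
    proof (intro image_subsetI)
      fix f assume f: "f \<in> F J"
      then have fI: "f \<in> I \<rightarrow>\<^sub>E C" by (simp add: F_def)
      have 1: "(\<lambda>i. if i \<in> b j then p i else f i) \<in> I \<rightarrow>\<^sub>E C"
        using fI bj by (auto simp: PiE_iff extensional_def subset_iff)
      have 2: "\<exists>i\<in>b k. (if i \<in> b j then p i else f i) \<noteq> p i" if k: "k \<in> J" for k
      proof -
        obtain i where "i \<in> b k" "f i \<noteq> p i" using f k by (auto simp: F_def)
        moreover from this(1) have "i \<notin> b j" using disj[OF k] by blast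
        ultimately show ?thesis by (intro bexI[of _ i]) auto
      qed
      have "restrict f (b j) \<in> b j \<rightarrow>\<^sub>E C" using fI bj(1) by (auto simp: PiE_iff)
      then show "\<phi> f \<in> G \<times> (b j \<rightarrow>\<^sub>E C)" using 1 2 by (auto simp: \<phi>_def G_def F_def)
    qed
    moreover have "finite (G \<times> (b j \<rightarrow>\<^sub>E C))" using fin fbj assms(2) by (auto simp: G_def finite_PiE)
    ultimately have "card (F J) \<le> card (G \<times> (b j \<rightarrow>\<^sub>E C))" by (rule card_inj_on_le)
    also have "\<dots> = card G * card C ^ card (b j)" using fbj by (simp add: card_cartesian_product card_PiE)
    finally have "real (card (F J)) \<le> real (card G) * real (card C) ^ card (b j)"
      by (metis of_nat_le_iff of_nat_mult of_nat_power)
    also have "\<dots> \<le> real (card G) * real (card C) ^ m"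
      using c1 bj(2) by (intro mult_left_mono power_increasing) auto
    finally have G: "real (card (F J)) / real (card C) ^ m \<le> real (card G)"
      using c1 by (simp add: divide_le_eq)
    have "F (insert j J) = F J - G" by (auto simp: F_def G_def)
    then have "card (F (insert j J)) = card (F J) - card G" "card G \<le> card (F J)"
      using fin by (auto simp: G_def card_Diff_subset intro: card_mono)
    then have "real (card (F (insert j J))) = real (card (F J)) - real (card G)" by simp
    also have "\<dots> \<le> (1 - 1 / real (card C) ^ m) * real (card (F J))"
      using G by (simp add: algebra_simps)
    also have "\<dots> \<le> (1 - 1 / real (card C) ^ m) * ((1 - 1 / real (card C) ^ m) ^ card J * real (card C) ^ card I)"
      using c1 by (intro mult_left_mono IH) auto
    finally show ?thesis using insert.hyps by (simp add: F_def mult.assoc)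
  qed
qed

text \<open>\<open>f (a, b)\<close> is the role that \<open>a\<close> plays in the pair \<open>{a, b}\<close>. Consecutive edges of a tight path share
  two vertices, so consistency makes the roles along the path periodic with period 3.\<close>

definition consistent :: "('a \<times> 'a \<Rightarrow> nat) \<Rightarrow> 'a set \<Rightarrow> bool" where
  "consistent f e \<longleftrightarrow> (\<exists>r. inj_on r e \<and> (\<forall>a\<in>e. \<forall>b\<in>e. a \<noteq> b \<longrightarrow> f (a, b) = r a))"

text \<open>Rows, columns and symbols of the cyclic Latin square: any two entries determine the third, so
  different triples share no pair.\<close>

definition latin_triple :: "nat \<Rightarrow> nat \<times> nat \<Rightarrow> nat set" where
  "latin_triple q = (\<lambda>(x, y). {x, q + y, 2 * q + (x + y) mod q})"

definition offdiag :: "'a set \<Rightarrow> ('a \<times> 'a) set" where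
  "offdiag e = {(a, b). a \<in> e \<and> b \<in> e \<and> a \<noteq> b}"

lemma mod_add_left_cancel:
  fixes q :: nat
  assumes "y < q" "y' < q" "(x + y) mod q = (x + y') mod q"
  shows "y = y'"
  using assms cong_less_modulus_unique_nat[of y y' q] by (simp add: cong_add_lcancel_nat cong_def[symmetric])

lemma latin_triples_disjoint:
  assumes "j \<in> {..<q} \<times> {..<q}" "k \<in> {..<q} \<times> {..<q}" "j \<noteq> k"
  shows "offdiag (latin_triple q j) \<inter> offdiag (latin_triple q k) = {}"
proof -
  obtain x y x' y' where jk: "j = (x, y)" "k = (x', y')" by (metis surj_pair)
  then have b: "x < q" "y < q" "x' < q" "y' < q" using assms by auto
  let ?z = "(x + y) mod q" and ?z' = "(x' + y') mod q"
  have z: "?z < q" "?z' < q" using b by auto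
  have c1: "x = x' \<Longrightarrow> ?z = ?z' \<Longrightarrow> y = y'" using mod_add_left_cancel[of y q y' x] b by auto
  have c2: "y = y' \<Longrightarrow> ?z = ?z' \<Longrightarrow> x = x'" using mod_add_left_cancel[of x q x' y] b by (auto simp: add.commute)
  have ne: "\<not> (x = x' \<and> y = y')" using assms(3) jk by simp
  have False if "a \<in> latin_triple q j" "a \<in> latin_triple q k" "b \<in> latin_triple q j" "b \<in> latin_triple q k" "a \<noteq> b" for a b
  proof -
    \<comment> \<open>The three entries of a triple lie in the disjoint intervals [0, q), [q, 2q)
      and [2q, 3q), so a common element forces the same coordinate to agree. Two common elements
      make two coordinates agree, hence all three.\<close>
    have *: "(d = x \<and> x = x') \<or> (d = q + y \<and> y = y') \<or> (d = 2 * q + ?z \<and> ?z = ?z')"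
      if "d \<in> latin_triple q j" "d \<in> latin_triple q k" for d
      using that b z unfolding jk latin_triple_def by (simp, elim disjE; linarith)
    show False using *[OF that(1,2)] *[OF that(3,4)] that(5) c1 c2 ne by metis
  qed
  then show ?thesis unfolding offdiag_def by blast
qed

lemma offdiag_card: "finite e \<Longrightarrow> card (offdiag e) \<le> card e * (card e - 1)"
proof -
  assume "finite e"
  have "offdiag e = Sigma e (\<lambda>a. e - {a})" by (auto simp: offdiag_def)
  then show ?thesis using \<open>finite e\<close> by simp
qed

lemma card_latin_triple:
  assumes "j \<in> {..<q} \<times> {..<q}"
  shows "card (latin_triple q j) = 3"
  using assms by (auto simp: latin_triple_def)

text \<open>The cyclic Latin square gives \<open>(t div 3)\<^sup>2\<close> triples in
  \<open>K\<close> whose sets of six ordered pairs are disjoint. On each of them a random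
  \<open>f\<close> gives all vertices their prescribed roles with probability 1 / 3^6 = 1 / 729,
  independently.\<close>

lemma card_no_consistent_triple:
  assumes K: "K \<subseteq> {..<n}" "card K = t"
  shows "real (card {f \<in> {..<n} \<times> {..<n} \<rightarrow>\<^sub>E {..<3}. \<forall>e\<subseteq>K. card e = 3 \<longrightarrow> \<not> consistent f e})
    \<le> (728 / 729) ^ (t div 3)\<^sup>2 * 3 ^ n\<^sup>2"
proof -
  define q where "q = t div 3"
  have "finite K" using K by (meson finite_lessThan finite_subset)
  then obtain h where h: "bij_betw h {..<t} K"
    using K(2) by (metis bij_betw_from_nat_into_finite)
  define g where "g = the_inv_into {..<t} h"
  have gh: "g (h x) = x" if "x < t" for x
    using h that by (simp add: g_def the_inv_into_f_f bij_betw_def)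
  \<comment> \<open>The prescribed role of a vertex is the interval of length \<open>q\<close>
    containing its index under \<open>h\<close>: 0 for rows, 1 for columns, 2 for symbols.\<close>
  define p where "p = (\<lambda>(a, b :: nat). g a div q)"
  let ?J = "{..<q} \<times> {..<q}" and ?I = "{..<n} \<times> {..<n}"
  define b where "b j = map_prod h h ` offdiag (latin_triple q j)" for j
  have q3: "3 * q \<le> t" by (simp add: q_def)
  have lt: "latin_triple q j \<subseteq> {..<t}" if j: "j \<in> ?J" for j
  proof -
    obtain x y where xy: "j = (x, y)" "x < q" "y < q" using j by blast
    then have "(x + y) mod q < q" by simp
    then have "2 * q + (x + y) mod q < t" "x < t" "q + y < t" using xy q3 by linarith+
    then show ?thesis using xy by (simp add: latin_triple_def)
  qed
  have od: "offdiag (latin_triple q j) \<subseteq> {..<t} \<times> {..<t}" if "j \<in> ?J" for j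
    using lt[OF that] by (auto simp: offdiag_def)
  have inj: "inj_on (map_prod h h) ({..<t} \<times> {..<t})"
    using h by (intro map_prod_inj_on) (auto simp: bij_betw_def)
  have part: "x div q < 3" if "x \<in> latin_triple q j" "j \<in> ?J" for x j
  proof -
    have "x < 3 * q" using that by (auto simp: latin_triple_def intro: add_strict_mono)
    then show ?thesis by (simp add: less_mult_imp_div_less)
  qed
  have "real (card {f \<in> ?I \<rightarrow>\<^sub>E {..<3}. \<forall>j\<in>?J. \<exists>i\<in>b j. f i \<noteq> p i})
      \<le> (1 - 1 / real (card {..<3::nat}) ^ 6) ^ card ?J * real (card {..<3::nat}) ^ card ?I"
  proof (rule card_avoiding_blocks)
    fix j assume j: "j \<in> ?J"
    have "b j \<subseteq> ?I" using od[OF j] h K(1) by (auto simp: b_def bij_betw_def)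
    moreover have "card (b j) \<le> 6"
    proof -
      have fin: "finite (latin_triple q j)" by (simp add: latin_triple_def split_beta)
      have "finite (offdiag (latin_triple q j))" using od[OF j] by (rule finite_subset) simp
      then have "card (b j) \<le> card (offdiag (latin_triple q j))" unfolding b_def by (rule card_image_le)
      also have "\<dots> \<le> 6" using offdiag_card[OF fin] card_latin_triple[OF j] by simp
      finally show ?thesis .
    qed
    moreover have "p ` b j \<subseteq> {..<3}"
      using lt[OF j] part[OF _ j] by (auto simp: b_def p_def offdiag_def gh subset_iff)
    ultimately show "b j \<subseteq> ?I \<and> card (b j) \<le> 6 \<and> p ` b j \<subseteq> {..<3}" by blast
  next
    fix j k assume jk: "j \<in> ?J" "k \<in> ?J" "j \<noteq> k"
    have "b j \<inter> b k = map_prod h h ` (offdiag (latin_triple q j) \<inter> offdiag (latin_triple q k))"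
      unfolding b_def using inj_on_image_Int[OF inj od[OF jk(1)] od[OF jk(2)]] by simp
    then show "b j \<inter> b k = {}" using latin_triples_disjoint[OF jk] by simp
  qed (auto simp: lessThan_empty_iff)
  moreover have "{f \<in> ?I \<rightarrow>\<^sub>E {..<3}. \<forall>e\<subseteq>K. card e = 3 \<longrightarrow> \<not> consistent f e}
      \<subseteq> {f \<in> ?I \<rightarrow>\<^sub>E {..<3}. \<forall>j\<in>?J. \<exists>i\<in>b j. f i \<noteq> p i}"
  \<comment> \<open>If \<open>f\<close> agreed with \<open>p\<close> on all six pairs of some Latin
    triple, the image of that triple in \<open>K\<close> would be consistent with role function
    \<open>g a div q\<close>.\<close>
  proof (rule Collect_mono, intro impI conjI ballI, elim conjE, assumption, rule ccontr)
    fix f j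
    assume f: "f \<in> ?I \<rightarrow>\<^sub>E {..<3} \<and> (\<forall>e\<subseteq>K. card e = 3 \<longrightarrow> \<not> consistent f e)" and j: "j \<in> ?J"
      and no: "\<not> (\<exists>i\<in>b j. f i \<noteq> p i)"
    obtain x y where j_def: "j = (x, y)" and xy: "x < q" "y < q" using j by blast
    note no = no[unfolded j_def]
    let ?T = "latin_triple q (x, y)"
    have J: "(x, y) \<in> ?J" using xy by simp
    have "card (h ` ?T) = card ?T"
      using h lt[OF J] by (intro card_image) (auto simp: bij_betw_def intro: inj_on_subset)
    moreover have "h ` ?T \<subseteq> K" using h lt[OF J] by (auto simp: bij_betw_def)
    moreover have "consistent f (h ` ?T)"
      unfolding consistent_def
    proof (intro exI[of _ "\<lambda>a. g a div q"] conjI ballI impI)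
      have dv: "x div q = 0" "(q + y) div q = 1" "(2 * q + (x + y) mod q) div q = 2"
        using xy by auto
      have "inj_on (\<lambda>a. a div q) ?T"
        unfolding latin_triple_def inj_on_def using dv by auto
      then show "inj_on (\<lambda>a. g a div q) (h ` ?T)"
        using lt[OF J] gh by (auto simp: inj_on_def subset_iff)
      fix a c assume ac: "a \<in> h ` ?T" "c \<in> h ` ?T" "a \<noteq> c"
      then obtain a' c' where "a' \<in> ?T" "c' \<in> ?T" "a = h a'" "c = h c'" by blast
      with ac have "(a, c) \<in> b (x, y)"
        unfolding b_def by (intro image_eqI[of _ _ "(a', c')"]) (auto simp: offdiag_def)
      then show "f (a, c) = g a div q" using no by (auto simp: p_def)
    qed
    ultimately show False using f card_latin_triple[OF J] by auto
  qed
  then have "card {f \<in> ?I \<rightarrow>\<^sub>E {..<3}. \<forall>e\<subseteq>K. card e = 3 \<longrightarrow> \<not> consistent f e}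
      \<le> card {f \<in> ?I \<rightarrow>\<^sub>E {..<3::nat}. \<forall>j\<in>?J. \<exists>i\<in>b j. f i \<noteq> p i}"
    by (intro card_mono) (auto simp: finite_PiE)
  ultimately show ?thesis by (simp add: q_def power2_eq_square)
qed

text \<open>Any three consecutive roles along the cycle are distinct elements of {0, 1, 2}, so the
  role sequence has period 3. Going once around the cycle also gives period \<open>s\<close>, which
  is impossible when 3 does not divide \<open>s\<close>.\<close>

lemma no_consistent_tight_cycle:
  fixes s :: nat
  assumes s: "s \<ge> 4" "s mod 3 \<noteq> 0"
    and g: "inj_on g {..<s}" "g ` {..<s} \<subseteq> {..<n}" and f: "f \<in> {..<n} \<times> {..<n} \<rightarrow> {..<3}"
    and con: "\<And>i. i < s \<Longrightarrow> consistent f {g i, g ((i + 1) mod s), g ((i + 2) mod s)}"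
  shows False
proof -
  \<comment> \<open>The cycle is unrolled to all natural numbers, so edges that wrap around need no
    separate treatment.\<close>
  define G where "G i = g (i mod s)" for i
  define P where "P i = f (G i, G (i + 1))" for i
  have s0: "s > 0" using s by simp
  have Gn: "G i < n" for i using subsetD[OF g(2), of "g (i mod s)"] s0 by (simp add: G_def)
  have P3: "P i < 3" for i using f Gn by (auto simp: P_def)
  have con': "consistent f {G i, G (i + 1), G (i + 2)}" for i
    using con[of "i mod s"] s0 by (simp add: G_def mod_simps)
  have neq: "G i \<noteq> G (i + d)" if "0 < d" "d < s" for i d
  proof
    assume "G i = G (i + d)"
    then have "i mod s = (i + d) mod s" using g(1) s0 by (auto simp: G_def dest: inj_onD)
    then have "s dvd d" by (metis add_diff_cancel_left' mod_eq_dvd_iff_nat le_add1)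
    then show False using that by (auto dest: dvd_imp_le)
  qed
  have n1: "G i \<noteq> G (i + 1)" "G i \<noteq> G (i + 2)" for i using neq[of 1 i] neq[of 2 i] s by auto
  have n2: "G (i + 1) \<noteq> G (i + 2)" for i using n1(1)[of "i + 1"] by simp
  \<comment> \<open>A vertex of an edge has one role towards both others. Hence the role of
    \<open>G (i + 1)\<close> towards its predecessor is also its role towards its successor, which
    links each edge to the next.\<close>
  have key: "f (G (i + 1), G i) = P (i + 1)" "distinct [P i, P (i + 1), f (G (i + 2), G (i + 1))]" for i
  proof -
    let ?e = "{G i, G (i + 1), G (i + 2)}"
    obtain r where r: "inj_on r ?e" "\<forall>a\<in>?e. \<forall>b\<in>?e. a \<noteq> b \<longrightarrow> f (a, b) = r a"
      using con'[of i, unfolded consistent_def] by (elim exE conjE)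
    note r = r(1) r(2)[rule_format]
    have "P i = r (G i)" "f (G (i + 1), G i) = r (G (i + 1))"
      unfolding P_def using n1[of i] by (intro r(2); simp)+
    moreover have "P (i + 1) = r (G (i + 1))" "f (G (i + 2), G (i + 1)) = r (G (i + 2))"
      using r(2)[of "G (i + 1)" "G (i + 2)"] r(2)[of "G (i + 2)" "G (i + 1)"] n2[of i]
      unfolding P_def by simp_all
    ultimately have *: "P i = r (G i)" "f (G (i + 1), G i) = r (G (i + 1))"
      "P (i + 1) = r (G (i + 1))" "f (G (i + 2), G (i + 1)) = r (G (i + 2))" by blast+
    show "f (G (i + 1), G i) = P (i + 1)" using *(2,3) by simp
    show "distinct [P i, P (i + 1), f (G (i + 2), G (i + 1))]"
      unfolding *(1,3,4) using inj_on_eq_iff[OF r(1)] n1[of i] n2[of i] by simp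
  qed
  have dist: "P i \<noteq> P (i + 1)" "P i \<noteq> P (i + 2)" "P (i + 1) \<noteq> P (i + 2)" for i
    using key(2)[of i] key(1)[of "i + 1"] by auto
  \<comment> \<open>Both \<open>P i\<close> and \<open>P (i + 3)\<close> are the one element of {0,
    1, 2} different from \<open>P (i + 1)\<close> and \<open>P (i + 2)\<close>.\<close>
  have "P (i + 3) = P i" for i
  proof -
    have eq: "i + 1 + 1 = i + 2" "i + 1 + 2 = i + 3" by simp_all
    show ?thesis
      using dist[of i] dist[of "i + 1", unfolded eq] P3[of i] P3[of "i + 1"] P3[of "i + 2"] P3[of "i + 3"]
      by linarith
  qed
  have per: "P (i + 3 * k) = P i" for i k
  proof (induction k)
    case (Suc k)
    then show ?case using \<open>\<And>i. P (i + 3) = P i\<close>[of "i + 3 * k"] by (simp add: algebra_simps)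
  qed simp
  have "P s = P 0" by (simp add: P_def G_def mod_Suc)
  moreover have "P s = P (s mod 3)" using per[of "s mod 3" "s div 3"] by simp
  moreover have "s mod 3 = 1 \<or> s mod 3 = 2" using s(2) by linarith
  ultimately show False using dist(1,2)[of 0] by (auto simp: numeral_2_eq_2)
qed

text \<open>Union bound over the at most \<open>n ^ t\<close> candidates for a blue clique: the
  hypothesis leaves some role function \<open>f\<close> for which every \<open>t\<close>-set
  contains a consistent triple. Colouring exactly the consistent triples red then avoids both
  configurations.\<close>

lemma not_arrows3_tight_cycle:
  assumes s: "s \<ge> 4" "s mod 3 \<noteq> 0" and n: "real n ^ t * (728 / 729) ^ (t div 3)\<^sup>2 < 1"
  shows "\<not> arrows3 n (tight_cycle3 s) (complete3 t)"
proof -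
  let ?O = "{..<n} \<times> {..<n} \<rightarrow>\<^sub>E {..<3::nat}"
  define bad where "bad K = {f \<in> ?O. \<forall>e\<subseteq>K. card e = 3 \<longrightarrow> \<not> consistent f e}" for K
  define \<K> where "\<K> = {K. K \<subseteq> {..<n} \<and> card K = t}"
  have fO: "finite ?O" by (simp add: finite_PiE)
  have fK: "finite \<K>" by (auto simp: \<K>_def)
  have "card \<K> = n choose t" by (simp add: \<K>_def n_subsets)
  also have "\<dots> \<le> n ^ t" by (cases "t \<le> n") (auto intro: binomial_le_pow simp: binomial_eq_0)
  finally have cK: "real (card \<K>) \<le> real n ^ t" by (metis of_nat_le_iff of_nat_power)
  have "real (card (\<Union>K\<in>\<K>. bad K)) \<le> (\<Sum>K\<in>\<K>. real (card (bad K)))"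
    using card_UN_le[OF fK, of bad] by (metis of_nat_le_iff of_nat_sum)
  also have "\<dots> \<le> real (card \<K>) * ((728 / 729) ^ (t div 3)\<^sup>2 * 3 ^ n\<^sup>2)"
    using card_no_consistent_triple[of _ n t] by (intro sum_bounded_above) (auto simp: bad_def \<K>_def)
  also have "\<dots> \<le> real n ^ t * ((728 / 729) ^ (t div 3)\<^sup>2 * 3 ^ n\<^sup>2)"
    using cK by (intro mult_right_mono) auto
  also have "\<dots> < 3 ^ n\<^sup>2" using mult_strict_right_mono[OF n, of "3 ^ n\<^sup>2"] by (simp add: mult.assoc)
  also have "\<dots> = real (card ?O)" by (simp add: card_PiE power2_eq_square)
  finally have "\<not> ?O \<subseteq> (\<Union>K\<in>\<K>. bad K)"
    using card_mono[of "\<Union>K\<in>\<K>. bad K" ?O] fK fO by (auto simp: bad_def)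
  then obtain f where f: "f \<in> ?O" "\<And>K. K \<in> \<K> \<Longrightarrow> f \<notin> bad K" by blast
  define c where "c e = (if consistent f e then Red else Blue)" for e
  have "\<not> contains_copy (colour_class (complete3 n) c Red) (tight_cycle3 s)"
  proof
    assume "contains_copy (colour_class (complete3 n) c Red) (tight_cycle3 s)"
    then obtain g where g: "inj_on g {..<s}" "g ` {..<s} \<subseteq> {..<n}"
      "\<And>e. e \<in> edges (tight_cycle3 s) \<Longrightarrow> c (g ` e) = Red"
      by (auto simp: contains_copy_def colour_class_def tight_cycle3_def complete3_def)
    have "consistent f {g i, g ((i + 1) mod s), g ((i + 2) mod s)}" if "i < s" for i
    proof -
      have "{i, (i + 1) mod s, (i + 2) mod s} \<in> edges (tight_cycle3 s)"
        using that by (auto simp: tight_cycle3_def)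
      from g(3)[OF this] show ?thesis by (simp add: c_def split: if_splits)
    qed
    then show False using no_consistent_tight_cycle[OF s g(1,2), of f] f(1) by (auto simp: PiE_def)
  qed
  moreover have "\<not> contains_copy (colour_class (complete3 n) c Blue) (complete3 t)"
  proof
    assume "contains_copy (colour_class (complete3 n) c Blue) (complete3 t)"
    then obtain g where g: "inj_on g {..<t}" "g ` {..<t} \<subseteq> {..<n}"
      "\<And>e. e \<subseteq> {..<t} \<Longrightarrow> card e = 3 \<Longrightarrow> c (g ` e) = Blue"
      by (auto simp: contains_copy_def colour_class_def complete3_def)
    have "g ` {..<t} \<in> \<K>" using g by (simp add: \<K>_def card_image)
    moreover have "\<not> consistent f e" if e: "e \<subseteq> g ` {..<t}" "card e = 3" for e
    proof -
      obtain e' where e': "e' \<subseteq> {..<t}" "e = g ` e'" using e(1) by (auto simp: subset_image_iff)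
      then have "card e' = 3" using e(2) g(1) by (metis card_image inj_on_subset)
      then show ?thesis using g(3)[OF e'(1)] e'(2) by (auto simp: c_def)
    qed
    ultimately show False using f(2)[of "g ` {..<t}"] f(1) unfolding bad_def by blast
  qed
  ultimately show ?thesis unfolding arrows3_def by blast
qed

section \<open>Exposing vertices\<close>

text \<open>Letting \<open>z\<close> range over \<open>W\<close> as well makes \<open>W\<close>
  itself a blue clique; this is what bounds the sets \<open>U\<close> and \<open>R u\<close> of the
  exposure process.\<close>

definition blue_pairs :: "('a set \<Rightarrow> bool) \<Rightarrow> 'a set \<Rightarrow> 'a set \<Rightarrow> bool" where
  "blue_pairs red W S \<longleftrightarrow>
    (\<forall>x\<in>W. \<forall>y\<in>W. \<forall>z\<in>W \<union> S. x \<noteq> y \<longrightarrow> x \<noteq> z \<longrightarrow> y \<noteq> z \<longrightarrow> \<not> red {x, y, z})"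

text \<open>Here a single vertex in \<open>W\<close> suffices. Including \<open>W\<close> in the
  ranges of \<open>y\<close> and \<open>z\<close> makes \<open>W\<close> a blue clique too.\<close>

definition blue_points :: "('a set \<Rightarrow> bool) \<Rightarrow> 'a set \<Rightarrow> 'a set \<Rightarrow> bool" where
  "blue_points red W S \<longleftrightarrow>
    (\<forall>x\<in>W. \<forall>y\<in>W \<union> S. \<forall>z\<in>W \<union> S. x \<noteq> y \<longrightarrow> x \<noteq> z \<longrightarrow> y \<noteq> z \<longrightarrow> \<not> red {x, y, z})"

text \<open>The state of the exposure process: \<open>S\<close> is the set of vertices still available, \<open>B\<close> consists of
  vertices that are blue to every remaining pair, pairs inside \<open>U\<close> are blue to every remaining vertex,
  and \<open>R u\<close> collects vertices whose pair with \<open>u\<close> is red to everything that remains.\<close>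

definition exposed ::
    "('a set \<Rightarrow> bool) \<Rightarrow> 'a set \<Rightarrow> 'a set \<Rightarrow> 'a set \<Rightarrow> 'a set \<Rightarrow> ('a \<Rightarrow> 'a set) \<Rightarrow> bool" where
  "exposed red V S B U R \<longleftrightarrow>
    S \<subseteq> V \<and> B \<subseteq> V - S \<and> U \<subseteq> V - S \<and> blue_points red B S \<and> blue_pairs red U S \<and>
    (\<forall>u\<in>U. R u \<subseteq> V - S - {u} \<and> blue_pairs red (R u) S \<and> (\<forall>r\<in>R u. \<forall>x\<in>S. red {u, r, x}))"

text \<open>The configuration contains \<open>K\<^sub>4\<close> on \<open>i, j, k, x\<close> and the tight cycle \<open>(i, j, x, k, y)\<close>.\<close>

definition red_cone :: "('a set \<Rightarrow> bool) \<Rightarrow> 'a set \<Rightarrow> bool" where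
  "red_cone red V \<longleftrightarrow> (\<exists>i j k x y. {i, j, k, x, y} \<subseteq> V \<and> distinct [i, j, k, x, y] \<and>
     red {i, j, k} \<and> red {i, j, x} \<and> red {i, j, y} \<and> red {i, k, x} \<and> red {i, k, y} \<and>
     red {j, k, x} \<and> red {j, k, y} \<and> red {k, x, y})"

lemma blue_pairs_subset: "blue_pairs red W S \<Longrightarrow> S' \<subseteq> S \<Longrightarrow> blue_pairs red W S'"
  unfolding blue_pairs_def by blast

lemma blue_points_subset: "blue_points red W S \<Longrightarrow> S' \<subseteq> S \<Longrightarrow> blue_points red W S'"
  unfolding blue_points_def by blast

text \<open>Since \<open>w\<close> comes from \<open>S\<close>, triples inside
  \<open>insert w W\<close> are blue by the old condition. Only those formed by \<open>w\<close>, a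
  vertex of \<open>W\<close> and a remaining vertex have to be checked anew.\<close>

lemma blue_pairs_insert:
  assumes W: "blue_pairs red W S" and "w \<in> S" "S' \<subseteq> S"
    and w: "\<And>u x. u \<in> W \<Longrightarrow> x \<in> S' \<Longrightarrow> \<not> red {u, w, x}"
  shows "blue_pairs red (insert w W) S'"
  unfolding blue_pairs_def
proof (intro ballI impI)
  fix x y z assume h: "x \<in> insert w W" "y \<in> insert w W" "z \<in> insert w W \<union> S'"
    "x \<noteq> y" "x \<noteq> z" "y \<noteq> z"
  have old: "\<not> red {a, b, c}" if "a \<in> W" "b \<in> W" "c \<in> W \<union> S" "a \<noteq> b" "a \<noteq> c" "b \<noteq> c" for a b c
    using W that unfolding blue_pairs_def by blast
  have w': "\<not> red {w, u, x}" if "u \<in> W" "x \<in> S'" for u x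
    using w[OF that] by (simp add: insert_commute)
  consider "x \<in> W" "y \<in> W" | "x = w" "y \<in> W" "z \<in> W" | "x = w" "y \<in> W" "z \<in> S'"
    | "y = w" "x \<in> W" "z \<in> W" | "y = w" "x \<in> W" "z \<in> S'"
    using h by blast
  then show "\<not> red {x, y, z}"
  proof cases
    case 1 then show ?thesis using h assms(2,3) by (intro old) auto
  next
    case 2 then show ?thesis using old[of y z w] h assms(2) by (simp add: insert_commute)
  next
    case 3 then show ?thesis using w' by blast
  next
    case 4 then show ?thesis using old[of x z w] h assms(2) by (simp add: insert_commute)
  next
    case 5 then show ?thesis using w by blast
  qed
qed

text \<open>A triple that meets \<open>W\<close> is blue by the old condition because
  \<open>w\<close> comes from \<open>S\<close>. This leaves the pairs in the link of
  \<open>w\<close> within \<open>S'\<close>.\<close>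

lemma blue_points_insert:
  assumes W: "blue_points red W S" and "w \<in> S" "S' \<subseteq> S"
    and w: "\<And>x y. x \<in> S' \<Longrightarrow> y \<in> S' \<Longrightarrow> x \<noteq> y \<Longrightarrow> \<not> red {w, x, y}"
  shows "blue_points red (insert w W) S'"
  unfolding blue_points_def
proof (intro ballI impI)
  fix x y z assume h: "x \<in> insert w W" "y \<in> insert w W \<union> S'" "z \<in> insert w W \<union> S'"
    "x \<noteq> y" "x \<noteq> z" "y \<noteq> z"
  have old: "\<not> red {a, b, c}" if "a \<in> W" "b \<in> W \<union> S" "c \<in> W \<union> S" "a \<noteq> b" "a \<noteq> c" "b \<noteq> c" for a b c
    using W that unfolding blue_points_def by blast
  have S: "y \<in> W \<union> S" "z \<in> W \<union> S" using h assms(2,3) by auto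
  consider "x \<in> W" | "x = w" "y \<in> W" | "x = w" "z \<in> W" | "x = w" "y \<in> S'" "z \<in> S'"
    using h by blast
  then show "\<not> red {x, y, z}"
  proof cases
    case 1 then show ?thesis using h S by (intro old) auto
  next
    case 2 then show ?thesis using old[of y x z] h S assms(2) by (simp add: insert_commute)
  next
    case 3 then show ?thesis using old[of z x y] h S assms(2) by (simp add: insert_commute)
  next
    case 4 then show ?thesis using w h by blast
  qed
qed

text \<open>Pigeonhole: if fewer than half of \<open>S\<close> avoids every \<open>u\<close>, more
  than half of it is covered by the at most \<open>t\<close> sets belonging to elements of
  \<open>U\<close>.\<close>

lemma popular_or_avoided:
  fixes P :: "'a \<Rightarrow> 'b \<Rightarrow> bool"
  assumes "finite U" "finite S" "card U \<le> t"
  shows "(\<exists>u\<in>U. card S \<le> 2 * t * card {x\<in>S. P u x}) \<or> card S \<le> 2 * card {x\<in>S. \<forall>u\<in>U. \<not> P u x}"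
proof (rule disjCI)
  assume few: "\<not> card S \<le> 2 * card {x\<in>S. \<forall>u\<in>U. \<not> P u x}"
  show "\<exists>u\<in>U. card S \<le> 2 * t * card {x\<in>S. P u x}"
  proof (rule ccontr)
    assume "\<not> ?thesis"
    then have *: "2 * t * card {x\<in>S. P u x} \<le> card S" if "u \<in> U" for u
      using that by force
    have "S \<subseteq> {x\<in>S. \<forall>u\<in>U. \<not> P u x} \<union> (\<Union>u\<in>U. {x\<in>S. P u x})" by blast
    then have "card S \<le> card ({x\<in>S. \<forall>u\<in>U. \<not> P u x} \<union> (\<Union>u\<in>U. {x\<in>S. P u x}))"
      using assms by (intro card_mono) auto
    also have "\<dots> \<le> card {x\<in>S. \<forall>u\<in>U. \<not> P u x} + (\<Sum>u\<in>U. card {x\<in>S. P u x})"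
      by (rule order_trans[OF card_Un_le add_left_mono[OF card_UN_le[OF assms(1)]]])
    finally have "card S < 2 * (\<Sum>u\<in>U. card {x\<in>S. P u x})" using few by linarith
    moreover have "2 * t * (\<Sum>u\<in>U. card {x\<in>S. P u x}) \<le> t * card S"
    proof -
      have "2 * t * (\<Sum>u\<in>U. card {x\<in>S. P u x}) = (\<Sum>u\<in>U. 2 * t * card {x\<in>S. P u x})"
        by (simp add: sum_distrib_left)
      also have "\<dots> \<le> of_nat (card U) * card S" by (rule sum_bounded_above) (use * in auto)
      also have "\<dots> \<le> t * card S" using assms(3) by simp
      finally show ?thesis .
    qed
    moreover have "t > 0"
      using calculation(1) assms(1,3) by (cases "U = {}") (auto simp: card_gt_0_iff intro: less_le_trans)
    ultimately show False
      using mult_strict_left_mono[of "card S" "2 * (\<Sum>u\<in>U. card {x\<in>S. P u x})" t]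
      by (simp add: mult.left_commute mult.assoc)
  qed
qed

text \<open>The exposed vertex \<open>w\<close> is added to \<open>U\<close>, to some
  \<open>R u\<close> or to \<open>B\<close>, so the total size of these sets counts the steps. At
  worst two factors of \<open>2 * t\<close> are lost, one for each use of
  \<open>popular_or_avoided\<close>.\<close>

lemma exposed_step:
  assumes ex: "exposed red V S B U R" and V: "finite V"
    and t: "card U \<le> t" "\<And>u. u \<in> U \<Longrightarrow> card (R u) \<le> t"
    and m: "m > 0" "8 * t\<^sup>2 * m \<le> card S" "t > 0"
  shows "red_cone red V \<or> (\<exists>S' B' U' R'. exposed red V S' B' U' R' \<and> m \<le> card S' \<and>
    card B' + card U' + (\<Sum>u\<in>U'. card (R' u)) = Suc (card B + card U + (\<Sum>u\<in>U. card (R u))))"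
proof -
  have sub: "S \<subseteq> V" "B \<subseteq> V - S" "U \<subseteq> V - S" "blue_points red B S" "blue_pairs red U S"
    and cls: "\<And>u. u \<in> U \<Longrightarrow> R u \<subseteq> V - S - {u}" "\<And>u. u \<in> U \<Longrightarrow> blue_pairs red (R u) S"
      "\<And>u r x. u \<in> U \<Longrightarrow> r \<in> R u \<Longrightarrow> x \<in> S \<Longrightarrow> red {u, r, x}"
    using ex unfolding exposed_def by auto
  have fin: "finite S" "finite B" "finite U" "\<And>u. u \<in> U \<Longrightarrow> finite (R u)"
    using sub cls(1) V by (meson finite_Diff finite_subset)+
  have t2: "t\<^sup>2 * m \<ge> 1" using m by simp
  then have "card S > 0" using m(2) by linarith
  then obtain w where w: "w \<in> S" by fastforce
  define S0 where "S0 = S - {w}"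
  have S0: "S0 \<subseteq> S" "finite S0" "w \<notin> S0" using fin by (auto simp: S0_def)
  have "card S0 = card S - 1" using w fin by (simp add: S0_def)
  \<comment> \<open>Dropping from 8 to 4 pays for the removal of \<open>w\<close>.\<close>
  then have cS0: "4 * t\<^sup>2 * m \<le> card S0" using m(2) t2 by simp
  have keep: "exposed red V S' B' U' R'"
    if "S' \<subseteq> S0" "B' = B \<or> B' = insert w B" "U' = U \<or> U' = insert w U"
      "blue_points red B' S'" "blue_pairs red U' S'"
      "\<And>u. u \<in> U' \<Longrightarrow> R' u \<subseteq> V - S' - {u} \<and> blue_pairs red (R' u) S' \<and> (\<forall>r\<in>R' u. \<forall>x\<in>S'. red {u, r, x})"
    for S' B' U' R'
    using that sub w S0 unfolding exposed_def by blast
  have cls': "R u \<subseteq> V - S' - {u} \<and> blue_pairs red (R u) S' \<and> (\<forall>r\<in>R u. \<forall>x\<in>S'. red {u, r, x})"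
    if "u \<in> U" "S' \<subseteq> S" for u S'
    using that cls(1)[of u] cls(3)[of u] blue_pairs_subset[OF cls(2)[of u]] by blast
  from popular_or_avoided[OF fin(3) S0(2) t(1), of "\<lambda>u x. red {u, w, x}"]
  consider (red) u where "u \<in> U" "card S0 \<le> 2 * t * card {x\<in>S0. red {u, w, x}}"
    | (blue) "card S0 \<le> 2 * card {x\<in>S0. \<forall>u\<in>U. \<not> red {u, w, x}}" by blast
  then show ?thesis
  proof cases
    case blue
    define S' where "S' = {x\<in>S0. \<forall>u\<in>U. \<not> red {u, w, x}}"
    have S': "S' \<subseteq> S0" "S' \<subseteq> S" using S0 by (auto simp: S'_def)
    have "4 * m \<le> 4 * (t\<^sup>2 * m)" using m(3) by simp
    then have "m \<le> card S'" using cS0 blue unfolding S'_def by linarith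
    \<comment> \<open>A new member of \<open>U\<close> starts with an empty set
      \<open>R w\<close>.\<close>
    moreover have "exposed red V S' B (insert w U) (R(w := {}))"
    proof (rule keep)
      show "blue_points red B S'" using blue_points_subset sub(4) S' by metis
      show "blue_pairs red (insert w U) S'"
        by (rule blue_pairs_insert[OF sub(5) w S'(2)]) (auto simp: S'_def)
      fix u assume "u \<in> insert w U"
      then show "(R(w := {})) u \<subseteq> V - S' - {u} \<and> blue_pairs red ((R(w := {})) u) S' \<and>
          (\<forall>r\<in>(R(w := {})) u. \<forall>x\<in>S'. red {u, r, x})"
        using cls'[of u S'] S' by (auto simp: blue_pairs_def)
    qed (use S' in auto)
    moreover have "w \<notin> U" using w sub by blast
    then have "card B + card (insert w U) + (\<Sum>u\<in>insert w U. card ((R(w := {})) u)) =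
        Suc (card B + card U + (\<Sum>u\<in>U. card (R u)))"
      using fin by (auto intro!: sum.cong)
    ultimately show ?thesis by blast
  next
    case red
    define S1 where "S1 = {x\<in>S0. red {u, w, x}}"
    have S1: "S1 \<subseteq> S0" "S1 \<subseteq> S" "finite S1" using S0 by (auto simp: S1_def)
    have "2 * t * (2 * t * m) \<le> 2 * t * card S1"
      using cS0 red(2) unfolding S1_def by (simp only: power2_eq_square mult.assoc mult.left_commute)
    then have cS1: "2 * t * m \<le> card S1" using m(3) by (simp add: mult.commute)
    from popular_or_avoided[OF fin(4)[OF red(1)] S1(3) t(2)[OF red(1)], of "\<lambda>r x. red {r, w, x}"]
    consider (redred) r where "r \<in> R u" "card S1 \<le> 2 * t * card {x\<in>S1. red {r, w, x}}"
      | (redblue) "card S1 \<le> 2 * card {x\<in>S1. \<forall>r\<in>R u. \<not> red {r, w, x}}" by blast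
    then show ?thesis
    proof cases
      case redblue
      define S' where "S' = {x\<in>S1. \<forall>r\<in>R u. \<not> red {r, w, x}}"
      have S': "S' \<subseteq> S1" "S' \<subseteq> S0" "S' \<subseteq> S" using S1 by (auto simp: S'_def)
      have "2 * m \<le> 2 * t * m" using m(3) by simp
      then have "m \<le> card S'" using cS1 redblue unfolding S'_def by linarith
      moreover have "exposed red V S' B U (R(u := insert w (R u)))"
      proof (rule keep)
        show "blue_points red B S'" using blue_points_subset sub(4) S' by metis
        show "blue_pairs red U S'" using blue_pairs_subset sub(5) S' by metis
        fix v assume v: "v \<in> U"
        have "blue_pairs red (insert w (R u)) S'"
          by (rule blue_pairs_insert[OF cls(2)[OF red(1)] w S'(3)]) (auto simp: S'_def)
        moreover have "insert w (R u) \<subseteq> V - S' - {u}"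
          using cls(1)[OF red(1)] sub w S' S0(3) red(1) by blast
        moreover have "\<forall>r\<in>insert w (R u). \<forall>x\<in>S'. red {u, r, x}"
          using cls(3)[OF red(1)] S' by (auto simp: S1_def)
        ultimately show "(R(u := insert w (R u))) v \<subseteq> V - S' - {v} \<and>
            blue_pairs red ((R(u := insert w (R u))) v) S' \<and>
            (\<forall>r\<in>(R(u := insert w (R u))) v. \<forall>x\<in>S'. red {v, r, x})"
          using cls'[OF v S'(3)] by (cases "v = u") auto
      qed (use S' in auto)
      moreover have "w \<notin> R u" using w cls(1)[OF red(1)] by blast
      then have "card B + card U + (\<Sum>v\<in>U. card ((R(u := insert w (R u))) v)) =
          Suc (card B + card U + (\<Sum>v\<in>U. card (R v)))"
        using fin red(1) by (simp add: sum.remove[OF fin(3) red(1)])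
      ultimately show ?thesis by blast
    next
      case redred
      \<comment> \<open>Every \<open>x\<close> in \<open>S'\<close> now forms a red
        \<open>K\<^sub>4\<close> with \<open>u\<close>, \<open>r\<close>, \<open>w\<close>. A red
        triple \<open>{w, x, y}\<close> with \<open>x\<close>, \<open>y\<close> in \<open>S'\<close>
        would complete the cone with \<open>i = u\<close>, \<open>j = r\<close>,
        \<open>k = w\<close>; if there is none, \<open>w\<close> is blue to all pairs in
        \<open>S'\<close> and joins \<open>B\<close>.\<close>
      define S' where "S' = {x\<in>S1. red {r, w, x}}"
      have S': "S' \<subseteq> S1" "S' \<subseteq> S0" "S' \<subseteq> S" using S1 by (auto simp: S'_def)
      have "2 * t * m \<le> 2 * t * card S'" using cS1 redred(2) unfolding S'_def by linarith
      then have mS': "m \<le> card S'" using m(3) by simp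
      show ?thesis
      proof (cases "\<exists>x\<in>S'. \<exists>y\<in>S'. x \<noteq> y \<and> red {w, x, y}")
        case True
        then obtain x y where xy: "x \<in> S'" "y \<in> S'" "x \<noteq> y" "red {w, x, y}" by blast
        have "red {u, r, w}" "red {u, r, x}" "red {u, r, y}"
          using cls(3)[OF red(1) redred(1)] w xy S' by auto
        moreover have "red {u, w, x}" "red {u, w, y}" "red {r, w, x}" "red {r, w, y}"
          using xy by (auto simp: S'_def S1_def)
        moreover have "distinct [u, r, w, x, y]" "{u, r, w, x, y} \<subseteq> V"
          using xy cls(1)[OF red(1)] redred(1) red(1) w sub S' S0 by auto
        ultimately have "red_cone red V" using xy(4) unfolding red_cone_def by blast
        then show ?thesis ..
      next
        case False
        have "exposed red V S' (insert w B) U R"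
        proof (rule keep)
          show "blue_points red (insert w B) S'"
            by (rule blue_points_insert[OF sub(4) w S'(3)]) (use False in blast)
          show "blue_pairs red U S'" using blue_pairs_subset sub(5) S' by metis
        qed (use S' cls' in auto)
        moreover have "w \<notin> B" using w sub by blast
        then have "card (insert w B) + card U + (\<Sum>v\<in>U. card (R v)) =
            Suc (card B + card U + (\<Sum>v\<in>U. card (R v)))"
          using fin by simp
        ultimately show ?thesis using mS' by blast
      qed
    qed
  qed
qed

lemma card3E:
  assumes "card e = 3"
  obtains x y z where "e = {x, y, z}" "x \<noteq> y" "x \<noteq> z" "y \<noteq> z"
  using assms by (auto simp: card_3_iff)

text \<open>Without a red cone the process could be run for t^2 steps. But \<open>B\<close>,
  \<open>U\<close> and all \<open>R u\<close> are blue cliques of at most t - 1 vertices, and 2 (t -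
  1) + (t - 1)^2 = t^2 - 1.\<close>

lemma red_cone_exists:
  assumes V: "finite V" and N: "(8 * t\<^sup>2) ^ t\<^sup>2 \<le> card V" and "t > 0"
    and noblue: "\<And>K. K \<subseteq> V \<Longrightarrow> card K = t \<Longrightarrow> \<exists>e\<subseteq>K. card e = 3 \<and> red e"
  shows "red_cone red V"
proof (rule ccontr)
  assume nc: "\<not> red_cone red V"
  have pairs: "card W < t" if "blue_pairs red W S" "W \<subseteq> V" for W S
  proof (rule ccontr)
    assume "\<not> card W < t"
    then obtain K where K: "K \<subseteq> W" "card K = t"
      using obtain_subset_with_card_n[of t W] by (auto simp: not_less)
    have "K \<subseteq> V" using K(1) that(2) by (rule subset_trans)
    then obtain e where e: "e \<subseteq> K" "card e = 3" "red e" using noblue[OF _ K(2)] by auto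
    obtain x y z where xyz: "e = {x, y, z}" "x \<noteq> y" "x \<noteq> z" "y \<noteq> z" using e(2) by (rule card3E)
    then have "x \<in> W" "y \<in> W" "z \<in> W" using e(1) K(1) by auto
    then show False using that(1) xyz e(3) unfolding blue_pairs_def by auto
  qed
  have points: "card W < t" if "blue_points red W S" "W \<subseteq> V" for W S
    by (rule pairs[of W S]) (use that in \<open>auto simp: blue_points_def blue_pairs_def\<close>)
  have bounds: "card B < t" "card U < t" "u \<in> U \<Longrightarrow> card (R u) < t"
    if "exposed red V S B U R" for S B U R u
  proof -
    show "card B < t" by (rule points[of B S]) (use that in \<open>auto simp: exposed_def\<close>)
    show "card U < t" by (rule pairs[of U S]) (use that in \<open>auto simp: exposed_def\<close>)
    show "card (R u) < t" if "u \<in> U"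
      by (rule pairs[of "R u" S]) (use that \<open>exposed red V S B U R\<close> in \<open>auto simp: exposed_def\<close>)
  qed
  \<comment> \<open>Each step divides the guaranteed size of \<open>S\<close> by
    \<open>8 * t\<^sup>2\<close>; after t^2 steps the guarantee is still 1.\<close>
  have reach: "\<exists>S B U R. exposed red V S B U R \<and> (8 * t\<^sup>2) ^ (t\<^sup>2 - k) \<le> card S \<and>
      card B + card U + (\<Sum>u\<in>U. card (R u)) = k" if "k \<le> t\<^sup>2" for k
    using that
  proof (induction k)
    case 0
    have "exposed red V V {} {} (\<lambda>_. {})"
      by (simp add: exposed_def blue_points_def blue_pairs_def)
    then show ?case using N by (intro exI[of _ V] exI[of _ "{}"] exI[of _ "\<lambda>_. {}"]) simp
  next
    case (Suc k)
    then obtain S B U R where st: "exposed red V S B U R" "(8 * t\<^sup>2) ^ (t\<^sup>2 - k) \<le> card S"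
      "card B + card U + (\<Sum>u\<in>U. card (R u)) = k" by auto
    have "t\<^sup>2 - k = Suc (t\<^sup>2 - Suc k)" using Suc.prems by simp
    then have "8 * t\<^sup>2 * (8 * t\<^sup>2) ^ (t\<^sup>2 - Suc k) \<le> card S" using st(2) by simp
    then show ?case
      using exposed_step[OF st(1) V, of t "(8 * t\<^sup>2) ^ (t\<^sup>2 - Suc k)"] bounds[OF st(1)] st(3) nc \<open>t > 0\<close>
      by (simp add: less_imp_le)
  qed
  then obtain S B U R where st: "exposed red V S B U R"
    "card B + card U + (\<Sum>u\<in>U. card (R u)) = t\<^sup>2" by blast
  have "(\<Sum>u\<in>U. card (R u)) \<le> of_nat (card U) * (t - 1)"
    by (rule sum_bounded_above) (use bounds(3)[OF st(1)] in force)
  also have "\<dots> \<le> (t - 1) * (t - 1)" using bounds(2)[OF st(1)] by auto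
  finally have "t\<^sup>2 \<le> (t - 1) + (t - 1) + (t - 1) * (t - 1)"
    using st(2) bounds(1,2)[OF st(1)] by linarith
  also obtain p where p: "t = Suc p" using \<open>t > 0\<close> by (cases t) auto
  have "(t - 1) + (t - 1) + (t - 1) * (t - 1) < t\<^sup>2" unfolding p by (simp add: power2_eq_square)
  finally show False by simp
qed

section \<open>Supersaturation\<close>

text \<open>Greedy choice of \<open>X\<close>: by averaging, some \<open>x\<close> lies in at least
  a fraction 1 / E of the sets \<open>N y\<close>. Restricting to those \<open>y\<close> and
  deleting \<open>x\<close> lowers each degree by one, and the surplus \<open>l\<close> keeps all
  degrees at least \<open>a\<close> throughout.\<close>

lemma common_neighbours:
  fixes N :: "'b \<Rightarrow> 'a set"
  assumes "finite A" "finite Y" "Y \<noteq> {}" "a > 0" "card A \<le> E * a"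
    and "\<And>y. y \<in> Y \<Longrightarrow> N y \<subseteq> A \<and> a + l \<le> card (N y)"
  shows "\<exists>X\<subseteq>A. card X = l \<and> card Y \<le> E ^ l * card {y\<in>Y. X \<subseteq> N y}"
  using assms
proof (induction l arbitrary: A Y N)
  case 0
  then show ?case by (intro exI[of _ "{}"]) auto
next
  case (Suc l)
  \<comment> \<open>Double counting of the pairs with \<open>x \<in> N y\<close>: from below by
    \<open>a\<close> for each \<open>y\<close>, and from above by the failure of the claim for each
    \<open>x\<close>.\<close>
  have "\<exists>x\<in>A. card Y \<le> E * card {y\<in>Y. x \<in> N y}"
  proof (rule ccontr)
    assume "\<not> ?thesis"
    then have *: "E * card {y\<in>Y. x \<in> N y} < card Y" if "x \<in> A" for x using that by force
    obtain y where "y \<in> Y" using Suc.prems(3) by blast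
    then have "A \<noteq> {}" using Suc.prems(6)[of y] by auto
    have "E * (\<Sum>x\<in>A. card {y\<in>Y. x \<in> N y}) = (\<Sum>x\<in>A. E * card {y\<in>Y. x \<in> N y})"
      by (simp add: sum_distrib_left)
    also have "\<dots> < (\<Sum>x\<in>A. card Y)"
      using * \<open>A \<noteq> {}\<close> Suc.prems(1) by (intro sum_strict_mono) auto
    finally have "E * (\<Sum>x\<in>A. card {y\<in>Y. x \<in> N y}) < card A * card Y" by simp
    also have "\<dots> \<le> E * (a * card Y)" using Suc.prems(5) by (simp add: mult.assoc[symmetric])
    also have "a * card Y \<le> (\<Sum>y\<in>Y. card (N y))"
    proof -
      have "a \<le> card (N y)" if "y \<in> Y" for y using Suc.prems(6)[OF that] by simp
      from sum_bounded_below[of Y a "\<lambda>y. card (N y)", OF this] show ?thesis by (simp add: mult.commute)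
    qed
    also have "(\<Sum>y\<in>Y. card (N y)) = (\<Sum>y\<in>Y. card {x\<in>A. x \<in> N y})"
      using Suc.prems(6) by (intro sum.cong refl arg_cong[where f = card]) auto
    also have "\<dots> = (\<Sum>x\<in>A. card {y\<in>Y. x \<in> N y})"
      by (rule sum_multicount_gen[OF Suc.prems(2,1)]) simp
    finally show False by simp
  qed
  then obtain x where x: "x \<in> A" "card Y \<le> E * card {y\<in>Y. x \<in> N y}" by blast
  define Y' where "Y' = {y\<in>Y. x \<in> N y}"
  have "card Y > 0" using Suc.prems by (simp add: card_gt_0_iff)
  then have "card Y' \<noteq> 0" using x(2) unfolding Y'_def by (intro notI) simp
  then have Y': "Y' \<noteq> {}" "finite Y'" using Suc.prems(2) by (auto simp: Y'_def)
  have "\<exists>X\<subseteq>A - {x}. card X = l \<and> card Y' \<le> E ^ l * card {y\<in>Y'. X \<subseteq> N y - {x}}"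
  proof (rule Suc.IH)
    show "card (A - {x}) \<le> E * a" using Suc.prems(5) by (meson card_Diff1_le le_trans)
    fix y assume "y \<in> Y'"
    then show "N y - {x} \<subseteq> A - {x} \<and> a + l \<le> card (N y - {x})"
      using Suc.prems(6)[of y] by (auto simp: Y'_def card_Diff_singleton)
  qed (use Suc.prems Y' in auto)
  then obtain X where X: "X \<subseteq> A - {x}" "card X = l" "card Y' \<le> E ^ l * card {y\<in>Y'. X \<subseteq> N y - {x}}"
    by blast
  have "{y\<in>Y'. X \<subseteq> N y - {x}} \<subseteq> {y\<in>Y. insert x X \<subseteq> N y}" by (auto simp: Y'_def)
  then have "card {y\<in>Y'. X \<subseteq> N y - {x}} \<le> card {y\<in>Y. insert x X \<subseteq> N y}"
    using Suc.prems by (intro card_mono) auto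
  then have "card Y' \<le> E ^ l * card {y\<in>Y. insert x X \<subseteq> N y}"
    using X(3) by (meson le_trans mult_le_mono2)
  then have "card Y \<le> E * (E ^ l * card {y\<in>Y. insert x X \<subseteq> N y})"
    using x(2) unfolding Y'_def by (meson le_trans mult_le_mono2)
  moreover have "card (insert x X) = Suc l"
    using X Suc.prems(1) by (metis Diff_iff card_insert_disjoint finite_Diff finite_subset insertI1 subset_iff)
  ultimately show ?case using X(1) x(1)
    by (intro exI[of _ "insert x X"]) (auto simp: mult.assoc)
qed

text \<open>Average density 1 / D means that at least a fraction 1 / (2 D) of the \<open>y\<close>
  have density at least 1 / (2 D). To these \<open>common_neighbours\<close> applies with
  \<open>E = 4 * D\<close>.\<close>

lemma dense_common_neighbours:
  fixes N :: "'b \<Rightarrow> 'a set"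
  assumes "finite A" "finite Y" "Y \<noteq> {}" "D > 0" "4 * D * (l + 1) \<le> card A"
    and N: "\<And>y. y \<in> Y \<Longrightarrow> N y \<subseteq> A"
    and dense: "card A * card Y \<le> D * (\<Sum>y\<in>Y. card (N y))"
  shows "\<exists>X\<subseteq>A. card X = l \<and> card Y \<le> (4 * D) ^ (l + 1) * card {y\<in>Y. X \<subseteq> N y}"
proof -
  define Y' where "Y' = {y\<in>Y. card A \<le> 2 * D * card (N y)}"
  have fY': "finite Y'" "Y' \<subseteq> Y" using assms by (auto simp: Y'_def)
  have "card Y > 0" using assms by (simp add: card_gt_0_iff)
  have "0 < 4 * D * (l + 1)" using assms(4) by simp
  then have Apos: "card A > 0" using assms(5) by linarith
  have "2 * D * (\<Sum>y\<in>Y. card (N y)) = (\<Sum>y\<in>Y'. 2 * D * card (N y)) + (\<Sum>y\<in>Y - Y'. 2 * D * card (N y))"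
    unfolding sum.subset_diff[OF fY'(2) assms(2), of "\<lambda>y. card (N y)"] distrib_left sum_distrib_left by (rule add.commute)
  also have "\<dots> \<le> (\<Sum>y\<in>Y'. 2 * D * card A) + (\<Sum>y\<in>Y - Y'. card A)"
    using N assms(1) fY' by (intro add_mono sum_mono mult_le_mono2 card_mono) (auto simp: Y'_def)
  also have "\<dots> \<le> card A * (2 * D * card Y' + card Y)"
    using assms(2) by (simp add: algebra_simps card_mono)
  finally have "card A * (2 * card Y) \<le> card A * (2 * D * card Y' + card Y)"
    using dense by linarith
  then have YY': "card Y \<le> 2 * D * card Y'" using Apos by simp
  then have "Y' \<noteq> {}" using \<open>card Y > 0\<close> by auto
  \<comment> \<open>The summand 1 compensates for rounding in \<open>card A \<le> 4 * D * a\<close>.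
    Halving the density from 1 / (2 D) to 1 / (4 D) leaves the room for
    \<open>a + l\<close>.\<close>
  define a where "a = card A div (4 * D) + 1"
  have big: "a + l \<le> card (N y)" if "y \<in> Y'" for y
  proof -
    have "4 * D * (l + 1) div (4 * D) \<le> card A div (4 * D)" using assms(5) by (rule div_le_mono)
    then have "l + 1 \<le> card A div (4 * D)" using assms(4) by simp
    moreover have "2 * (card A div (4 * D)) \<le> card (N y)"
    proof -
      have "2 * D * (2 * (card A div (4 * D))) \<le> card A" 
        using div_times_less_eq_dividend[of "card A" "4 * D"] by (simp add: algebra_simps)
      also have "\<dots> \<le> 2 * D * card (N y)" using that by (simp add: Y'_def)
      finally show ?thesis using assms(4) by simp
    qed
    ultimately show ?thesis by (simp add: a_def)
  qed
  have "card A \<le> 4 * D * a"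
    using dividend_less_times_div[of "4 * D" "card A"] assms(4) by (simp add: a_def)
  moreover have "N y \<subseteq> A \<and> a + l \<le> card (N y)" if "y \<in> Y'" for y
    using that big N fY'(2) by blast
  moreover have "a > 0" by (simp add: a_def)
  ultimately obtain X where X: "X \<subseteq> A" "card X = l" "card Y' \<le> (4 * D) ^ l * card {y\<in>Y'. X \<subseteq> N y}"
    using common_neighbours[OF assms(1) fY'(1) \<open>Y' \<noteq> {}\<close>, of a "4 * D" N l] by blast
  have "card {y\<in>Y'. X \<subseteq> N y} \<le> card {y\<in>Y. X \<subseteq> N y}"
    using fY' assms(2) by (intro card_mono) auto
  then have "card Y' \<le> (4 * D) ^ l * card {y\<in>Y. X \<subseteq> N y}" using X(3) by (meson le_trans mult_le_mono2)
  then have "card Y \<le> 2 * D * ((4 * D) ^ l * card {y\<in>Y. X \<subseteq> N y})"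
    using YY' by (meson le_trans mult_le_mono2)
  also have "\<dots> \<le> (4 * D) ^ (l + 1) * card {y\<in>Y. X \<subseteq> N y}" by simp
  finally show ?thesis using X by blast
qed

text \<open>One coordinate at a time, a dense set of functions is replaced by those for which a common
  \<open>l\<close>-set of values can be substituted at that coordinate.\<close>

lemma blow_up_coordinate:
  assumes "finite I" "i \<in> I" "finite A" "F \<subseteq> I \<rightarrow>\<^sub>E A"
    and "D > 0" "4 * D * (l + 1) \<le> card A" "card A ^ card I \<le> D * card F"
  shows "\<exists>X\<subseteq>A. card X = l \<and>
    card A ^ card I \<le> (4 * D) ^ (l + 1) * card {f \<in> I \<rightarrow>\<^sub>E A. \<forall>x\<in>X. f(i := x) \<in> F}"
proof -
  let ?Y = "I \<rightarrow>\<^sub>E A"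
  have "0 < 4 * D * (l + 1)" using assms(5) by simp
  then have Apos: "card A > 0" using assms(6) by linarith
  have fY: "finite ?Y" using assms by (simp add: finite_PiE)
  have cY: "card ?Y = card A ^ card I" using assms(1) by (simp add: card_PiE)
  then have "card ?Y > 0" using Apos by simp
  then have "?Y \<noteq> {}" by force
  define N where "N f = {x\<in>A. f(i := x) \<in> F}" for f
  have "card (F \<times> A) = card (Sigma ?Y N)"
  proof (rule bij_betw_same_card)
    \<comment> \<open>Exchanging the value at coordinate \<open>i\<close> with the separate element
      \<open>x\<close> is an involution; it counts pairs in \<open>F \<times> A\<close> by the
      function that gets modified.\<close>
    show "bij_betw (\<lambda>(g, x). (g(i := x), g i)) (F \<times> A) (Sigma ?Y N)"
      by (rule bij_betw_byWitness[where f' = "\<lambda>(f, x). (f(i := x), f i)"])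
        (use assms(2,4) in \<open>auto simp: N_def PiE_iff extensional_def subset_iff split: if_splits\<close>)
  qed
  also have "\<dots> = (\<Sum>f\<in>?Y. card (N f))" using fY assms(3) by (simp add: N_def)
  finally have S: "(\<Sum>f\<in>?Y. card (N f)) = card F * card A" by (simp add: card_cartesian_product)
  have "card A * card ?Y \<le> D * (\<Sum>f\<in>?Y. card (N f))"
    unfolding S cY using assms(7) by (simp add: mult.commute mult.left_commute)
  then obtain X where X: "X \<subseteq> A" "card X = l" "card ?Y \<le> (4 * D) ^ (l + 1) * card {f\<in>?Y. X \<subseteq> N f}"
    using dense_common_neighbours[OF assms(3) fY \<open>?Y \<noteq> {}\<close> assms(5,6), of N] by (auto simp: N_def)
  have "{f\<in>?Y. X \<subseteq> N f} = {f\<in>?Y. \<forall>x\<in>X. f(i := x) \<in> F}" using X(1) by (auto simp: N_def)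
  then show ?thesis using X cY by auto
qed

text \<open>With \<open>n \<ge> 4\<close> the factor 4 is absorbed into a power of \<open>n\<close>,
  so that in an iteration only exponents change, by \<open>e\<close> becoming
  \<open>(e + 1) * (l + 1)\<close>.\<close>

lemma blow_up_coordinate_power:
  assumes "finite I" "i \<in> I" "finite A" "F \<subseteq> I \<rightarrow>\<^sub>E A"
    and "n \<ge> 4" "4 * n ^ e * (l + 1) \<le> card A" "card A ^ card I \<le> n ^ e * card F"
  shows "\<exists>X\<subseteq>A. card X = l \<and>
    card A ^ card I \<le> n ^ ((e + 1) * (l + 1)) * card {f \<in> I \<rightarrow>\<^sub>E A. \<forall>x\<in>X. f(i := x) \<in> F}"
proof -
  have "n ^ e > 0" using assms(5) by simp
  from blow_up_coordinate[OF assms(1-4) this assms(6,7)] obtain X where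
    X: "X \<subseteq> A" "card X = l" "card A ^ card I \<le> (4 * n ^ e) ^ (l + 1) * card {f \<in> I \<rightarrow>\<^sub>E A. \<forall>x\<in>X. f(i := x) \<in> F}"
    by blast
  have "(4 * n ^ e) ^ (l + 1) \<le> (n * n ^ e) ^ (l + 1)" using assms(5) by (intro power_mono) auto
  also have "\<dots> = n ^ ((e + 1) * (l + 1))" by (metis Suc_eq_plus1 power_Suc power_mult)
  finally show ?thesis using X order_trans[OF X(3) mult_le_mono1] by blast
qed

text \<open>The map taking \<open>e\<close> to \<open>(e + 1) * (l + 1)\<close>, applied three times
  to the initial exponent 4, gives the density exponent before the fourth blow-up. The summand
  \<open>2 + l\<close> covers the size condition \<open>4 * n ^ e * (l + 1) \<le> card A\<close>
  there.\<close>

definition blow_up_exponent :: "nat \<Rightarrow> nat" where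
  "blow_up_exponent l = 2 + l + ((((4 + 1) * (l + 1) + 1) * (l + 1) + 1) * (l + 1))"

text \<open>A function \<open>f\<close> selects one element from each of \<open>n\<close> copies of
  \<open>A\<close>. Pigeonhole over at most n^4 quadruples of indices fixes one that works for a
  fraction n^-4 of all \<open>f\<close>; its four coordinates are then blown up in turn.\<close>

lemma blow_up_four:
  assumes "finite A" "n \<ge> 4" "n ^ blow_up_exponent l \<le> card A"
    and P: "\<And>f. f \<in> {..<n} \<rightarrow>\<^sub>E A \<Longrightarrow>
      \<exists>i<n. \<exists>j<n. \<exists>k<n. \<exists>m<n. distinct [i, j, k, m] \<and> P i j k m (f i) (f j) (f k) (f m)"
  obtains i j k m X1 X2 X3 X4 where "i < n" "j < n" "k < n" "m < n" "distinct [i, j, k, m]"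
    "X1 \<subseteq> A" "X2 \<subseteq> A" "X3 \<subseteq> A" "X4 \<subseteq> A" "card X1 = l" "card X2 = l" "card X3 = l" "card X4 = l"
    "\<forall>x1\<in>X1. \<forall>x2\<in>X2. \<forall>x3\<in>X3. \<forall>x4\<in>X4. P i j k m x1 x2 x3 x4"
proof -
  let ?Y = "{..<n} \<rightarrow>\<^sub>E A"
  let ?L = "card A ^ card {..<n}"
  define T where "T = {p :: (nat \<times> nat) \<times> nat \<times> nat. case p of ((i, j), k, m) \<Rightarrow>
    i < n \<and> j < n \<and> k < n \<and> m < n \<and> distinct [i, j, k, m]}"
  define F where "F = (\<lambda>((i, j), k, m). {f\<in>?Y. P i j k m (f i) (f j) (f k) (f m)})"
  have fY: "finite ?Y" using assms by (simp add: finite_PiE)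
  have cY: "card ?Y = ?L" by (simp add: card_PiE)
  have T: "T \<subseteq> ({..<n} \<times> {..<n}) \<times> {..<n} \<times> {..<n}" by (auto simp: T_def)
  have cT: "card T \<le> n ^ 4"
    using card_mono[OF _ T] by (simp add: card_cartesian_product power4_eq_xxxx mult.assoc)
  have fT: "finite T" by (rule finite_subset[OF T]) simp
  have "n ^ blow_up_exponent l > 0" using assms(2) by simp
  then have cA: "card A > 0" using assms(3) by linarith
  have "\<exists>p\<in>T. ?L \<le> n ^ 4 * card (F p)"
  proof (rule ccontr)
    assume "\<not> ?thesis"
    then have *: "n ^ 4 * card (F p) < ?L" if "p \<in> T" for p using that by force
    have cov: "?Y \<subseteq> (\<Union>p\<in>T. F p)"
    proof
      fix f assume "f \<in> ?Y"
      then obtain i j k m where "i < n" "j < n" "k < n" "m < n" "distinct [i, j, k, m]"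
        "P i j k m (f i) (f j) (f k) (f m)" using P by blast
      then have "((i, j), k, m) \<in> T" "f \<in> F ((i, j), k, m)" using \<open>f \<in> ?Y\<close> by (auto simp: T_def F_def)
      then show "f \<in> (\<Union>p\<in>T. F p)" by blast
    qed
    have "finite (\<Union>p\<in>T. F p)" using fT fY by (auto simp: F_def)
    from card_mono[OF this cov] have "?L \<le> (\<Sum>p\<in>T. card (F p))"
      using card_UN_le[OF fT, of F] cY by simp
    then have 1: "n ^ 4 * ?L \<le> (\<Sum>p\<in>T. n ^ 4 * card (F p))"
      by (simp add: sum_distrib_left[symmetric])
    have "?L > 0" using cA by simp
    then have "T \<noteq> {}" using \<open>?L \<le> (\<Sum>p\<in>T. card (F p))\<close> by auto
    then have "(\<Sum>p\<in>T. n ^ 4 * card (F p)) < (\<Sum>p\<in>T. ?L)"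
      using * fT by (intro sum_strict_mono) auto
    also have "\<dots> \<le> n ^ 4 * ?L" using cT by simp
    finally show False using 1 by linarith
  qed
  then obtain i j k m where ijkm: "i < n" "j < n" "k < n" "m < n" "distinct [i, j, k, m]"
    and F0: "?L \<le> n ^ 4 * card {f\<in>?Y. P i j k m (f i) (f j) (f k) (f m)}" (is "_ \<le> _ * card ?F0")
    by (auto simp: T_def F_def)
  have big: "4 * n ^ e * (l + 1) \<le> card A" if "e + 1 + (l + 1) \<le> blow_up_exponent l" for e
  proof -
    have "(2::nat) ^ (l + 1) \<le> n ^ (l + 1)" using assms(2) by (intro power_mono) auto
    then have "l + 1 \<le> n ^ (l + 1)" using less_exp[of "l + 1"] by linarith
    then have "4 * n ^ e * (l + 1) \<le> n * n ^ e * n ^ (l + 1)" using assms(2) by (intro mult_mono) auto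
    also have "\<dots> = n ^ (e + 1 + (l + 1))" by (simp add: power_add)
    also have "\<dots> \<le> n ^ blow_up_exponent l" using that assms(2) by (intro power_increasing) auto
    finally show ?thesis using assms(3) by linarith
  qed
  let ?e1 = "(4 + 1) * (l + 1)" and ?e2 = "((4 + 1) * (l + 1) + 1) * (l + 1)"
    and ?e3 = "(((4 + 1) * (l + 1) + 1) * (l + 1) + 1) * (l + 1)"
  have e: "4 \<le> ?e1" "?e1 \<le> ?e2" "?e2 \<le> ?e3" "?e3 + 1 + (l + 1) \<le> blow_up_exponent l"
    by (auto simp: blow_up_exponent_def)
  have b: "4 * n ^ 4 * (l + 1) \<le> card A" "4 * n ^ ?e1 * (l + 1) \<le> card A"
    "4 * n ^ ?e2 * (l + 1) \<le> card A" "4 * n ^ ?e3 * (l + 1) \<le> card A"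
    using e by (intro big; linarith)+
  define F0 where "F0 = {f\<in>?Y. P i j k m (f i) (f j) (f k) (f m)}"
  have F0: "?L \<le> n ^ 4 * card F0" "F0 \<subseteq> ?Y" using F0 by (auto simp: F0_def)
  obtain X1 where X1: "X1 \<subseteq> A" "card X1 = l"
      "?L \<le> n ^ ?e1 * card {f\<in>?Y. \<forall>x\<in>X1. f(i := x) \<in> F0}"
    using blow_up_coordinate_power[OF _ _ assms(1) F0(2) assms(2) b(1) F0(1), of i] ijkm by auto
  define F1 where "F1 = {f\<in>?Y. \<forall>x\<in>X1. f(i := x) \<in> F0}"
  have F1: "?L \<le> n ^ ?e1 * card F1" "F1 \<subseteq> ?Y" using X1(3) by (auto simp only: F1_def)
  obtain X2 where X2: "X2 \<subseteq> A" "card X2 = l"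
      "?L \<le> n ^ ?e2 * card {f\<in>?Y. \<forall>x\<in>X2. f(j := x) \<in> F1}"
    using blow_up_coordinate_power[OF _ _ assms(1) F1(2) assms(2) b(2) F1(1), of j] ijkm by auto
  define F2 where "F2 = {f\<in>?Y. \<forall>x\<in>X2. f(j := x) \<in> F1}"
  have F2: "?L \<le> n ^ ?e2 * card F2" "F2 \<subseteq> ?Y" using X2(3) by (auto simp only: F2_def)
  obtain X3 where X3: "X3 \<subseteq> A" "card X3 = l"
      "?L \<le> n ^ ?e3 * card {f\<in>?Y. \<forall>x\<in>X3. f(k := x) \<in> F2}"
    using blow_up_coordinate_power[OF _ _ assms(1) F2(2) assms(2) b(3) F2(1), of k] ijkm by auto
  define F3 where "F3 = {f\<in>?Y. \<forall>x\<in>X3. f(k := x) \<in> F2}"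
  have F3: "?L \<le> n ^ ?e3 * card F3" "F3 \<subseteq> ?Y" using X3(3) by (auto simp only: F3_def)
  obtain X4 where X4: "X4 \<subseteq> A" "card X4 = l"
      "?L \<le> n ^ ((?e3 + 1) * (l + 1)) * card {f\<in>?Y. \<forall>x\<in>X4. f(m := x) \<in> F3}" (is "_ \<le> _ * card ?F4")
    using blow_up_coordinate_power[OF _ _ assms(1) F3(2) assms(2) b(4) F3(1), of m] ijkm by auto
  have "?L > 0" using cA by simp
  then have "card ?F4 \<noteq> 0" using X4(3) by (intro notI) simp
  then have "?F4 \<noteq> {}" by (intro notI) simp
  then obtain f where f: "f \<in> ?F4" by blast
  \<comment> \<open>The substitutions are undone in the reverse order of the blow-ups. As the
    indices are distinct, no update overwrites another.\<close>
  have "P i j k m x1 x2 x3 x4" if x: "x1 \<in> X1" "x2 \<in> X2" "x3 \<in> X3" "x4 \<in> X4" for x1 x2 x3 x4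
  proof -
    have "f(m := x4) \<in> F3" using f x(4) by blast
    then have "f(m := x4, k := x3) \<in> F2" using x(3) by (simp add: F3_def)
    then have "f(m := x4, k := x3, j := x2) \<in> F1" using x(2) by (simp add: F2_def)
    then have "f(m := x4, k := x3, j := x2, i := x1) \<in> F0" using x(1) by (simp add: F1_def)
    then show ?thesis using ijkm(5) by (simp add: F0_def)
  qed
  then show ?thesis
    using ijkm X1(1,2) X2(1,2) X3(1,2) X4(1,2) by (intro that[of i j k m X1 X2 X3 X4] ballI)
qed

section \<open>Tight cycles in the configurations\<close>

lemma red_cone_K4:
  assumes "red_cone red V"
  shows "\<exists>a b c d. {a, b, c, d} \<subseteq> V \<and> distinct [a, b, c, d] \<and>
    (\<forall>e\<subseteq>{a, b, c, d}. card e = 3 \<longrightarrow> red e)"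
proof -
  obtain a b c d where *: "{a, b, c, d} \<subseteq> V" "distinct [a, b, c, d]"
    "red {a, b, c}" "red {a, b, d}" "red {a, c, d}" "red {b, c, d}"
    using assms unfolding red_cone_def by auto
  have "red e" if e: "e \<subseteq> {a, b, c, d}" "card e = 3" for e
  proof -
    have "card ({a, b, c, d} - e) = 1"
      using *(2) e by (subst card_Diff_subset) (auto intro: finite_subset)
    then obtain v where v: "{a, b, c, d} - e = {v}" by (auto simp: card_1_singleton_iff)
    then have "e = {a, b, c, d} - {v}" "v \<in> {a, b, c, d}" using e(1) by auto
    then have "e \<in> {{a, b, c}, {a, b, d}, {a, c, d}, {b, c, d}}" using *(2) by auto
    then show ?thesis using *(3-6) by auto
  qed
  then show ?thesis using *(1,2) by blast
qed

lemma contains_tight_cycleI: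
  assumes "s \<ge> 4" and g: "inj_on g {..<s}" "g ` {..<s} \<subseteq> {..<n}"
    and red: "\<And>i. i < s \<Longrightarrow> c {g i, g ((i + 1) mod s), g ((i + 2) mod s)} = k"
  shows "contains_copy (colour_class (complete3 n) c k) (tight_cycle3 s)"
  unfolding contains_copy_def
proof (intro exI[of _ g] conjI ballI)
  fix e assume e: "e \<in> edges (tight_cycle3 s)"
  then have "e \<subseteq> {..<s}" "card e = 3"
    using is_3graph_tight_cycle3[OF assms(1)] by (auto simp: is_3graph_def tight_cycle3_def)
  then have "card (g ` e) = 3" "g ` e \<subseteq> {..<n}"
    using g by (auto simp: card_image inj_on_subset)
  moreover have "c (g ` e) = k" using e red by (auto simp: tight_cycle3_def)
  ultimately show "g ` e \<in> edges (colour_class (complete3 n) c k)"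
    by (simp add: colour_class_def complete3_def)
qed (use g in \<open>auto simp: colour_class_def complete3_def tight_cycle3_def\<close>)

lemma red_cone_tight_cycle5:
  assumes "red_cone (\<lambda>e. c e = k) {..<n}"
  shows "contains_copy (colour_class (complete3 n) c k) (tight_cycle3 5)"
proof -
  obtain i j l x y where *: "{i, j, l, x, y} \<subseteq> {..<n}" "distinct [i, j, l, x, y]"
    "c {i, j, x} = k" "c {i, j, y} = k" "c {i, l, y} = k" "c {j, l, x} = k" "c {l, x, y} = k"
    using assms unfolding red_cone_def by blast
  let ?g = "\<lambda>m. [i, j, x, l, y] ! m"
  have five: "{..<5} = {0, 1, 2, 3, 4::nat}" by auto
  show ?thesis
  proof (rule contains_tight_cycleI[of _ ?g])
    show "inj_on ?g {..<5}" using *(2) by (intro inj_on_nth) auto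
    show "?g ` {..<5} \<subseteq> {..<n}" using *(1) unfolding five by auto
    fix m :: nat assume "m < 5"
    then have "m \<in> {0, 1, 2, 3, 4}" by auto
    then show "c {?g m, ?g ((m + 1) mod 5), ?g ((m + 2) mod 5)} = k"
      using *(3-7) by (elim insertE) (simp_all add: insert_commute)
  qed simp
qed

text \<open>A homomorphism to \<open>K\<^sub>4\<close>, given by a cyclic word: 012 repeated and
  then 3 if \<open>s\<close> is 1 modulo 3; 012 repeated at least once and then 30123 if
  \<open>s\<close> is 2 modulo 3.\<close>

lemma tight_cycle_K4_colouring:
  fixes s :: nat
  assumes "s \<ge> 6" "s mod 3 \<noteq> 0"
  shows "\<exists>\<tau>. (\<forall>i. \<tau> i < (4::nat)) \<and>
    (\<forall>i<s. distinct [\<tau> i, \<tau> ((i + 1) mod s), \<tau> ((i + 2) mod s)])"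
proof -
  have suc: "(i + 1) mod s = (if i + 1 < s then i + 1 else 0)"
    "(i + 2) mod s = (if i + 2 < s then i + 2 else i + 2 - s)" if "i < s" for i
    using that assms(1) by (auto simp: mod_if)
  have mod3: "i mod 3 \<noteq> (i + 1) mod 3" "i mod 3 \<noteq> (i + 2) mod 3" "(i + 1) mod 3 \<noteq> (i + 2) mod 3"
    for i :: nat by presburger+
  consider k where "s = 3 * k + 1" "k \<ge> 2" | k where "s = 3 * k + 5" "k \<ge> 1"
  proof (cases "s mod 3 = 1")
    case True
    then have "s = 3 * (s div 3) + 1" by presburger
    then show ?thesis using that(1)[of "s div 3"] assms(1) by linarith
  next
    case False
    then have "s = 3 * (s div 3 - 1) + 5" using assms by presburger
    then show ?thesis using that(2)[of "s div 3 - 1"] assms(1) by linarith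
  qed
  then show ?thesis
  proof cases
    case 1
    let ?t = "\<lambda>i. if i = 3 * k then 3 else i mod 3"
    have "distinct [?t i, ?t ((i + 1) mod s), ?t ((i + 2) mod s)]" if i: "i < s" for i
    proof -
      consider "i + 2 < 3 * k" | "i + 2 = 3 * k" | "i + 1 = 3 * k" | "i = 3 * k" using i 1 by linarith
      then show ?thesis
      proof cases
        case 1
        then show ?thesis unfolding suc[OF i] using mod3[of i] \<open>s = 3 * k + 1\<close> by simp
      next
        case 2
        then have "i mod 3 = 1" "(i + 1) mod 3 = 2" by presburger+
        with 2 show ?thesis unfolding suc[OF i] using \<open>s = 3 * k + 1\<close> by simp
      next
        case 3
        then have "i mod 3 = 2" by presburger
        with 3 show ?thesis unfolding suc[OF i] using \<open>s = 3 * k + 1\<close> \<open>k \<ge> 2\<close> by simp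
      next
        case 4
        then show ?thesis unfolding suc[OF i] using \<open>s = 3 * k + 1\<close> \<open>k \<ge> 2\<close> by simp
      qed
    qed
    moreover have "?t i < 4" for i using mod_less_divisor[of 3 i] by (auto simp del: mod_less_divisor)
    ultimately show ?thesis by (intro exI[of _ ?t] conjI allI impI)
  next
    case 2
    let ?t = "\<lambda>i. if i = 3 * k \<or> i = 3 * k + 4 then 3 else if i < 3 * k then i mod 3 else i - (3 * k + 1)"
    have lt: "?t i < 4" if "i < s" for i using that 2 mod_less_divisor[of 3 i] by simp linarith
    have "distinct [?t i, ?t ((i + 1) mod s), ?t ((i + 2) mod s)]" if i: "i < s" for i
    proof -
      consider "i + 2 < 3 * k" | "i + 2 = 3 * k" | "i + 1 = 3 * k"
        | "i = 3 * k" | "i = 3 * k + 1" | "i = 3 * k + 2" | "i = 3 * k + 3" | "i = 3 * k + 4"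
        using i 2 by linarith
      then show ?thesis
      proof cases
        case 1
        then show ?thesis unfolding suc[OF i] using mod3[of i] \<open>s = 3 * k + 5\<close> by simp
      next
        case 2
        then have "i mod 3 = 1" "(i + 1) mod 3 = 2" by presburger+
        with 2 show ?thesis unfolding suc[OF i] using \<open>s = 3 * k + 5\<close> by simp
      next
        case 3
        then have "i mod 3 = 2" by presburger
        with 3 show ?thesis unfolding suc[OF i] using \<open>s = 3 * k + 5\<close> \<open>k \<ge> 1\<close> by simp
      qed (unfold suc[OF i], use \<open>s = 3 * k + 5\<close> \<open>k \<ge> 1\<close> in simp_all)
    qed
    \<comment> \<open>Positions from \<open>s\<close> onwards get the default 0, since the bound 4
      on \<open>?t\<close> is available only below \<open>s\<close>.\<close>
    then have "distinct [if i < s then ?t i else 0, if (i + 1) mod s < s then ?t ((i + 1) mod s) else 0,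
        if (i + 2) mod s < s then ?t ((i + 2) mod s) else 0]" if "i < s" for i
      using that assms(1) by (simp only: if_True mod_less_divisor)
    moreover have "(if i < s then ?t i else 0) < 4" for i 
      using lt[of i] by (cases "i < s") (simp_all only: if_True if_False zero_less_numeral)
    ultimately show ?thesis by (intro exI[of _ "\<lambda>i. if i < s then ?t i else 0"] conjI allI impI)
  qed
qed

text \<open>The vertices form \<open>N\<close> blocks of length \<open>L\<close>. Every transversal
  contains a \<open>K\<^sub>4\<close> of colour \<open>k\<close>, so \<open>blow_up_four\<close>
  yields four parts of size \<open>s\<close> with all triples across three parts of colour
  \<open>k\<close>; a 4-colouring of the cycle embeds it there.\<close>

lemma K4_blow_up_tight_cycle:
  assumes s: "s \<ge> 6" "s mod 3 \<noteq> 0" and N: "N \<ge> 4" and L: "L = N ^ blow_up_exponent s"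
    and K4: "\<And>V. V \<subseteq> {..<N * L} \<Longrightarrow> card V = N \<Longrightarrow> \<exists>a b u d. {a, b, u, d} \<subseteq> V \<and> distinct [a, b, u, d] \<and>
      (\<forall>e\<subseteq>{a, b, u, d}. card e = 3 \<longrightarrow> c e = k)"
  shows "contains_copy (colour_class (complete3 (N * L)) c k) (tight_cycle3 s)"
proof -
  define h where "h i x = i * L + x" for i x
  have hd: "h i x div L = i" if "x < L" for i x using that by (simp add: h_def)
  have hm: "h i x mod L = x" if "x < L" for i x using that by (simp add: h_def)
  have hlt: "h i x < N * L" if "i < N" "x < L" for i x
  proof -
    have "h i x < i * L + L" using that by (simp add: h_def)
    also have "\<dots> = Suc i * L" by simp
    also have "\<dots> \<le> N * L" using that by (intro mult_le_mono1) simp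
    finally show ?thesis .
  qed
  define P where "P i j u m x1 x2 x3 x4 \<longleftrightarrow>
    (\<forall>e\<subseteq>{h i x1, h j x2, h u x3, h m x4}. card e = 3 \<longrightarrow> c e = k)" for i j u m x1 x2 x3 x4
  have P: "\<exists>i<N. \<exists>j<N. \<exists>u<N. \<exists>m<N. distinct [i, j, u, m] \<and> P i j u m (f i) (f j) (f u) (f m)"
    if f: "f \<in> {..<N} \<rightarrow>\<^sub>E {..<L}" for f
  proof -
    have fL: "f i < L" if "i < N" for i using f that by (auto simp: PiE_iff)
    let ?H = "\<lambda>i. h i (f i)"
    have "inj_on ?H {..<N}" by (rule inj_onI) (metis fL hd lessThan_iff)
    then have "card (?H ` {..<N}) = N" by (simp add: card_image)
    moreover have "?H ` {..<N} \<subseteq> {..<N * L}" using hlt fL by auto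
    ultimately have "\<exists>a b u d. {a, b, u, d} \<subseteq> ?H ` {..<N} \<and> distinct [a, b, u, d] \<and>
        (\<forall>e\<subseteq>{a, b, u, d}. card e = 3 \<longrightarrow> c e = k)" by (intro K4)
    then obtain a b u d where Q: "{a, b, u, d} \<subseteq> ?H ` {..<N}" "distinct [a, b, u, d]"
      "\<forall>e\<subseteq>{a, b, u, d}. card e = 3 \<longrightarrow> c e = k"
      by (elim exE conjE)
    have "a \<in> ?H ` {..<N}" "b \<in> ?H ` {..<N}" "u \<in> ?H ` {..<N}" "d \<in> ?H ` {..<N}" using Q(1) by simp_all
    then obtain i j v m where lt: "i < N" "j < N" "v < N" "m < N"
      and eq: "a = ?H i" "b = ?H j" "u = ?H v" "d = ?H m"
      by (elim imageE) simp
    have "distinct [i, j, v, m]" using Q(2) unfolding eq by auto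
    moreover have "P i j v m (f i) (f j) (f v) (f m)" using Q(3) unfolding eq P_def .
    ultimately show ?thesis using lt by blast
  qed
  have "finite {..<L}" "N ^ blow_up_exponent s \<le> card {..<L}" by (simp_all add: L)
  from blow_up_four[OF this(1) N this(2) P] obtain i j u m X1 X2 X3 X4
    where ijum: "i < N" "j < N" "u < N" "m < N" "distinct [i, j, u, m]"
      and X: "X1 \<subseteq> {..<L}" "X2 \<subseteq> {..<L}" "X3 \<subseteq> {..<L}" "X4 \<subseteq> {..<L}"
        "card X1 = s" "card X2 = s" "card X3 = s" "card X4 = s"
      and XP: "\<forall>x1\<in>X1. \<forall>x2\<in>X2. \<forall>x3\<in>X3. \<forall>x4\<in>X4. P i j u m x1 x2 x3 x4"
    .
  define idx where "idx a = [i, j, u, m] ! a" for a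
  define Z where "Z a = [X1, X2, X3, X4] ! a" for a
  have four: "a < 4 \<longleftrightarrow> a = 0 \<or> a = 1 \<or> a = 2 \<or> a = 3" for a :: nat by auto
  have Z: "Z a \<subseteq> {..<L}" "card (Z a) = s" "idx a < N" if "a < 4" for a
    using that X ijum unfolding four by (auto simp: Z_def idx_def)
  have idx_inj: "a = b" if "idx a = idx b" "a < 4" "b < 4" for a b
    using that nth_eq_iff_index_eq[OF ijum(5), of a b] by (simp add: idx_def)
  have "\<exists>E. bij_betw E {..<s} (Z a)" if "a < 4" for a
    using Z[OF that] by (metis finite_lessThan finite_subset bij_betw_from_nat_into_finite)
  then obtain E where E: "\<And>a. a < 4 \<Longrightarrow> bij_betw (E a) {..<s} (Z a)" by metis
  have EZ: "E a p \<in> Z a" if "a < 4" "p < s" for a p using E[OF that(1)] that(2) by (auto simp: bij_betw_def)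
  have EL: "E a p < L" if "a < 4" "p < s" for a p using EZ[OF that] Z(1)[OF that(1)] by auto
  obtain \<tau> where \<tau>: "\<And>i. \<tau> i < (4::nat)"
    "\<And>i. i < s \<Longrightarrow> distinct [\<tau> i, \<tau> ((i + 1) mod s), \<tau> ((i + 2) mod s)]"
    using tight_cycle_K4_colouring[OF s] by blast
  \<comment> \<open>Position \<open>p\<close> of the cycle takes the element with index
    \<open>p\<close> in its part, so positions of equal colour get different vertices.\<close>
  define g where "g p = h (idx (\<tau> p)) (E (\<tau> p) p)" for p
  have inj: "inj_on g {..<s}"
  proof (rule inj_onI)
    fix p q assume pq: "p \<in> {..<s}" "q \<in> {..<s}" "g p = g q"
    then have "idx (\<tau> p) = idx (\<tau> q)" "E (\<tau> p) p = E (\<tau> q) q"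
      unfolding g_def using hd hm EL \<tau>(1) by (metis lessThan_iff)+
    then have "\<tau> p = \<tau> q" "E (\<tau> p) p = E (\<tau> p) q" using idx_inj \<tau>(1) by metis+
    then show "p = q" using E[OF \<tau>(1)] pq(1,2) by (auto simp: bij_betw_def dest: inj_onD)
  qed
  show ?thesis
  proof (rule contains_tight_cycleI[OF _ inj])
    show "g ` {..<s} \<subseteq> {..<N * L}" using hlt Z(3) EL \<tau>(1) by (auto simp: g_def)
    fix p assume p: "p < s"
    define p1 p2 where "p1 = (p + 1) mod s" and "p2 = (p + 2) mod s"
    have ps: "p1 < s" "p2 < s" using s by (auto simp: p1_def p2_def)
    have d: "distinct [\<tau> p, \<tau> p1, \<tau> p2]" using \<tau>(2)[OF p] by (simp add: p1_def p2_def)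
    \<comment> \<open>\<open>XP\<close> needs a vertex from each of the four parts: the edge
      supplies three, and the remaining part takes its element with index \<open>p2\<close>.\<close>
    define w where "w a = (if a = \<tau> p then p else if a = \<tau> p1 then p1 else p2)" for a
    have ws: "w a < s" for a using p ps by (simp add: w_def)
    let ?v = "\<lambda>a. h (idx a) (E a (w a))"
    have "E 0 (w 0) \<in> X1" "E 1 (w 1) \<in> X2" "E 2 (w 2) \<in> X3" "E 3 (w 3) \<in> X4"
      using EZ[OF _ ws, of 0] EZ[OF _ ws, of 1] EZ[OF _ ws, of 2] EZ[OF _ ws, of 3] by (auto simp: Z_def)
    from XP[rule_format, OF this] have red: "c e = k" if "e \<subseteq> ?v ` {0, 1, 2, 3}" "card e = 3" for e
      using that unfolding P_def idx_def by simp
    have "g p = ?v (\<tau> p)" "g p1 = ?v (\<tau> p1)" "g p2 = ?v (\<tau> p2)"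
      using d by (auto simp: g_def w_def)
    moreover have "\<tau> q \<in> {0, 1, 2, 3}" for q using \<tau>(1)[of q] by auto
    ultimately have "{g p, g p1, g p2} \<subseteq> ?v ` {0, 1, 2, 3}" by blast
    moreover have "p \<noteq> p1" "p \<noteq> p2" "p1 \<noteq> p2" using d by auto
    then have "card {g p, g p1, g p2} = 3" using inj_on_eq_iff[OF inj] p ps by simp
    ultimately have "c {g p, g p1, g p2} = k" by (rule red)
    then show "c {g p, g ((p + 1) mod s), g ((p + 2) mod s)} = k" by (simp add: p1_def p2_def)
  qed (use s in simp)
qed

section \<open>Assembling the two bounds\<close>

lemma arrows3_tight_cycle:
  assumes s: "s \<ge> 5" "s mod 3 \<noteq> 0" and t: "t > 0"
  shows "arrows3 ((8 * t\<^sup>2) ^ (t\<^sup>2 * (blow_up_exponent s + 1))) (tight_cycle3 s) (complete3 t)"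
  unfolding arrows3_def
proof (rule allI, rule disjCI)
  fix c
  define N where "N = (8 * t\<^sup>2) ^ t\<^sup>2"
  define L where "L = N ^ blow_up_exponent s"
  let ?n = "(8 * t\<^sup>2) ^ (t\<^sup>2 * (blow_up_exponent s + 1))"
  have n: "?n = N * L" by (simp add: N_def L_def power_mult[symmetric] power_add[symmetric] algebra_simps)
  have "8 * t\<^sup>2 \<ge> 8" using t by simp
  then have "N \<ge> 8 ^ t\<^sup>2" unfolding N_def by (rule power_mono) simp
  moreover have "(8::nat) \<le> 8 ^ t\<^sup>2" using t by (intro self_le_power) auto
  ultimately have N4: "N \<ge> 4" by linarith
  then have "L \<ge> 1" by (simp add: L_def)
  assume noblue: "\<not> contains_copy (colour_class (complete3 ?n) c Blue) (complete3 t)"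
  have blue: "\<exists>e\<subseteq>K. card e = 3 \<and> c e = Red" if K: "K \<subseteq> {..<?n}" "card K = t" for K
  proof (rule ccontr)
    assume no: "\<not> ?thesis"
    have "finite K" using K(1) by (rule finite_subset) simp
    have "contains_copy (colour_class (complete3 ?n) c Blue) (complete3 t)"
    proof (rule contains_copyI_clique[OF is_3graph_complete3, of t K])
      fix e assume e: "e \<subseteq> K" "card e = 3"
      then have "c e = Blue" using no by (cases "c e") auto
      then show "e \<in> edges (colour_class (complete3 ?n) c Blue)"
        using e K(1) by (auto simp: colour_class_def complete3_def)
    qed (use K \<open>finite K\<close> in \<open>auto simp: colour_class_def complete3_def\<close>)
    then show False using noblue by blast
  qed
  have cone: "red_cone (\<lambda>e. c e = Red) V" if V: "V \<subseteq> {..<?n}" "N \<le> card V" for V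
  proof (rule red_cone_exists[OF _ _ t])
    show "finite V" using V(1) by (rule finite_subset) simp
    show "(8 * t\<^sup>2) ^ t\<^sup>2 \<le> card V" using V(2) by (simp add: N_def)
  qed (use blue V(1) in blast)
  show "contains_copy (colour_class (complete3 ?n) c Red) (tight_cycle3 s)"
  \<comment> \<open>Any two vertices of \<open>C\<^sub>5\<close> share an edge, so it does not map
    to \<open>K\<^sub>4\<close> and has to be found in the cone itself.\<close>
  proof (cases "s = 5")
    case True
    have "N \<le> ?n" unfolding n using \<open>L \<ge> 1\<close> by simp
    then show ?thesis using red_cone_tight_cycle5[OF cone] True by simp
  next
    case False
    show ?thesis
      unfolding n
    proof (rule K4_blow_up_tight_cycle[OF _ s(2) N4 L_def])
      show "s \<ge> 6" using s(1) False by simp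
      fix V assume "V \<subseteq> {..<N * L}" "card V = N"
      then show "\<exists>a b u d. {a, b, u, d} \<subseteq> V \<and> distinct [a, b, u, d] \<and>
          (\<forall>e\<subseteq>{a, b, u, d}. card e = 3 \<longrightarrow> c e = Red)"
        using red_cone_K4[OF cone, of V] n by simp
    qed
  qed
qed

text \<open>For \<open>t \<ge> 8\<close> the base \<open>8 * t\<^sup>2\<close> is at most
  \<open>t ^ 3\<close>, which gives the constant 3; passing from base e to base 2 doubles
  it.\<close>

lemma tight_cycle_ramsey_upper:
  assumes s: "s \<ge> 5" "s mod 3 \<noteq> 0" and t: "t \<ge> 8"
  shows "real (ramsey3 (tight_cycle3 s) (complete3 t))
    < 2 powr (6 * real (blow_up_exponent s + 1) * (real t)\<^sup>2 * ln (real t))"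
proof -
  let ?e = "blow_up_exponent s + 1"
  have "t > 0" using t by simp
  have "ramsey3 (tight_cycle3 s) (complete3 t) \<le> (8 * t\<^sup>2) ^ (t\<^sup>2 * ?e)"
    unfolding ramsey3_def by (rule Least_le, rule arrows3_tight_cycle[OF s \<open>t > 0\<close>])
  also have "\<dots> \<le> (t ^ 3) ^ (t\<^sup>2 * ?e)"
    using t by (intro power_mono) (auto simp: power2_eq_square power3_eq_cube)
  also have "\<dots> = t ^ (3 * (t\<^sup>2 * ?e))" by (simp only: power_mult)
  finally have "real (ramsey3 (tight_cycle3 s) (complete3 t)) \<le> real t ^ (3 * (t\<^sup>2 * ?e))"
    by (metis of_nat_le_iff of_nat_power)
  also have "\<dots> = exp (real (3 * (t\<^sup>2 * ?e)) * ln (real t))"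
    using t by (simp only: exp_of_nat_mult) simp
  also have "\<dots> < exp (6 * real ?e * (real t)\<^sup>2 * ln (real t) * ln 2)"
  proof -
    \<comment> \<open>From e \<le> 3 < 4.\<close>
    have "ln (exp 1) < ln ((2::real)\<^sup>2)" using exp_le by (subst ln_less_cancel_iff) auto
    then have "ln (2::real) > 1 / 2" by (simp only: ln_realpow ln_exp zero_less_numeral)
    moreover have "3 * real ?e * (real t)\<^sup>2 * ln (real t) > 0" using t by simp
    ultimately have "3 * real ?e * (real t)\<^sup>2 * ln (real t) * 1 <
        3 * real ?e * (real t)\<^sup>2 * ln (real t) * (2 * ln 2)"
      by (intro mult_strict_left_mono) auto
    then show ?thesis by (simp add: algebra_simps)
  qed
  also have "\<dots> = 2 powr (6 * real ?e * (real t)\<^sup>2 * ln (real t))" by (simp add: powr_def)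
  finally show ?thesis .
qed

text \<open>With c = 729 / 728 and t div 3 \<ge> t / 6, a fixed \<open>t\<close>-set is blue with
  probability at most c^(-t^2 / 36). If n \<le> c^(t / 72), there are at most c^(t^2 / 72) such
  sets, so the union bound succeeds.\<close>

lemma tight_cycle_ramsey_lower:
  assumes s: "s \<ge> 4" "s mod 3 \<noteq> 0" and t: "t \<ge> 4"
  shows "2 powr (log 2 (729 / 728) / 72 * real t) < real (ramsey3 (tight_cycle3 s) (complete3 t))"
proof (rule ccontr)
  define n where "n = ramsey3 (tight_cycle3 s) (complete3 t)"
  define c :: real where "c = 729 / 728"
  assume "\<not> ?thesis"
  then have n: "real n \<le> 2 powr (log 2 c / 72 * real t)" by (simp add: n_def c_def)
  define q where "q = t div 3"
  have "real t / 6 \<le> real q" using t by (simp add: q_def)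
  then have "(real t / 6)\<^sup>2 \<le> (real q)\<^sup>2" by (intro power_mono) auto
  then have q: "(real t)\<^sup>2 / 36 \<le> real (q\<^sup>2)" by (simp add: power_divide)
  have "real n ^ t \<le> (2 powr (log 2 c / 72 * real t)) ^ t" using n by (intro power_mono) auto
  also have "\<dots> = (2 powr log 2 c) powr ((real t)\<^sup>2 / 72)"
    by (simp only: powr_powr powr_realpow[symmetric] powr_gt_zero) (simp add: power2_eq_square mult.assoc)
  also have "\<dots> = c powr ((real t)\<^sup>2 / 72)" by (simp add: c_def)
  finally have "real n ^ t \<le> c powr ((real t)\<^sup>2 / 72)" .
  moreover have "(728 / 729) ^ q\<^sup>2 = c powr (- real (q\<^sup>2))"
    by (simp add: c_def powr_minus powr_realpow power_inverse[symmetric] del: of_nat_power)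
  ultimately have "real n ^ t * (728 / 729) ^ q\<^sup>2 \<le> c powr ((real t)\<^sup>2 / 72) * c powr (- real (q\<^sup>2))"
    by (simp add: mult_right_mono)
  also have "\<dots> = c powr ((real t)\<^sup>2 / 72 - real (q\<^sup>2))" by (simp add: powr_add[symmetric])
  also have "\<dots> < c powr 0"
  proof (rule powr_less_mono)
    have "(real t)\<^sup>2 > 0" using t by simp
    then show "(real t)\<^sup>2 / 72 - real (q\<^sup>2) < 0" using q by linarith
  qed (simp add: c_def)
  also have "\<dots> = 1" by (simp add: c_def)
  finally have "\<not> arrows3 n (tight_cycle3 s) (complete3 t)"
    unfolding q_def by (rule not_arrows3_tight_cycle[OF s])
  moreover have "arrows3 n (tight_cycle3 s) (complete3 t)"
    unfolding n_def using is_3graph_tight_cycle3[OF s(1)] is_3graph_complete3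
    by (intro arrows3_ramsey3) (auto simp: tight_cycle3_def complete3_def)
  ultimately show False by blast
qed

theorem theorem1p1:
  fixes s :: nat
  assumes "s \<ge> 5" and "s mod 3 \<noteq> 0"
  shows "\<exists>a b :: real. a > 0 \<and> b > 0 \<and>
    (\<exists>t0 :: nat. \<forall>t \<ge> t0.
      2 powr (a * real t) < real (ramsey3 (tight_cycle3 s) (complete3 t)) \<and>
      real (ramsey3 (tight_cycle3 s) (complete3 t)) < 2 powr (b * (real t)^2 * ln (real t)))"
proof (intro exI conjI allI impI)
  show "log 2 (729 / 728) / 72 > (0::real)" by simp
  show "6 * real (blow_up_exponent s + 1) > 0" by simp
  \<comment> \<open>The threshold 8 comes from the upper bound; the lower bound holds from 4
    on.\<close>
  fix t :: nat assume "8 \<le> t"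
  then show "2 powr (log 2 (729 / 728) / 72 * real t) < real (ramsey3 (tight_cycle3 s) (complete3 t))"
    "real (ramsey3 (tight_cycle3 s) (complete3 t))
      < 2 powr (6 * real (blow_up_exponent s + 1) * (real t)^2 * ln (real t))"
    using tight_cycle_ramsey_lower[of s t] tight_cycle_ramsey_upper[of s t] assms by auto
qed

end
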